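(* Let $r\ge1$, $\delta\ge2$, $m\ge1$, $\Delta\ge0$ be integers and set $$n_L=r+\delta-1,\quad \alpha=d=n_L-1,\quad \beta=1,\quad K_L=r\alpha-\binom r2,\quad N_L=\binom{n_L}{2},\quad \Delta_L=N_L-K_L+1 .$$ Let $\mathcal{A}$ be a pyramid code over $\mathbb{F}_q$ with $(K_L,\Delta_L)$ information locality, composed of $m$ support-disjoint local codes $\mathcal{A}_1,\dots,\mathcal{A}_m$, each an $[N_L,K_L,\Delta_L]$ MDS code, together with $\Delta\alpha$ global parity symbols, with overall parameters $[mN_L+\Delta\alpha,\ mK_L,\ \Delta_L+\Delta\alpha]$. Let $\mathcal{C}$ be the vector code over $\mathbb{F}_q$ with vector-size parameter $\alpha$ obtained from $\mathcal{A}$ as follows: for each $i\in[m]$ the $N_L$ code symbols of $\mathcal{A}_i$ are placed bijectively on the edges of a complete graph on $n_L$ vertices, giving $n_L$ vector symbols (nodes), each node storing the $\alpha=n_L-1$ symbols on its incident edges; and the $\Delta\alpha$ global parity symbols are partitioned into $\Delta$ groups of $\alpha$ symbols, each group forming one further vector symbol. Then $\mathcal{C}$ is an MBR-local code with $(r,\delta)$ information locality composed of $m$ support-disjoint local codes $\{\mathcal{C}_i\}_{i=1}^m$, each of which is a repair-by-transfer $((n_L,r,d),(\alpha,\beta),K_L)$ MBR code, along with $\Delta$ global parity (vector) symbols. Moreover $\mathcal{C}$ has length $n=mn_L+\Delta$, scalar dimension $K=mK_L$, and minimum distance $$d_{\min}=n-\frac{K}{K_L}r+1-\left(\frac{K}{K_L}-1\right)(\delta-1)=\Delta+\delta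 .$$
   Context: Vector codes. An $\mathbb{F}_q$-linear vector code of block length $n$ with vector-size parameter $\alpha$ is an $\mathbb{F}_q$-linear subspace $\mathcal{C}$ of $(\mathbb{F}_q^\alpha)^n$; its scalar dimension is $K=\dim_{\mathbb{F}_q}\mathcal{C}$; $G$ is a $K\times n\alpha$ generator matrix of the expanded scalar code, the $i$-th thick column being the $\alpha$ columns of the $i$-th vector symbol. Standing assumption: the $\alpha$ columns in each thick column are linearly independent. $G|_S$ and $\mathcal{C}|_S$ denote restriction to thick columns/vector symbols in $S\subseteq[n]$. $d_{\min}$ is the minimum Hamming weight, counted in vector symbols, of a nonzero codeword. MBR codes. A linear exact-repair $((n,k,d),(\alpha,\beta),B)$ regenerating code ($k\le d\le n-1$) is a vector code of block length $n$, vector-size parameter $\alpha$, scalar dimension $B$ such that (i) every codeword is determined by any $k$ of its vector symbols; (ii) for every $i$ and every $D\subseteq[n]\setminus\{i\}$, $|D|=d$, there are $\mathbb{F}_q$-linear maps $\varphi_h:\mathbb{F}_q^\alpha\to\mathbb{F}_q^\beta$, $h\in D$, such that $\mathbf{c}_i$ is determined by $(\varphi_h(\mathbf{c}_h))_{h\in D}$ for every codeword $\mathbf{c}$. It is an MBR code if $\alpha=d\beta$ and $B=\sum_{i=0}^{k-1}(d-i)\beta$. The repair-by-transfer MBR code with $d=n-1$, $\alpha=n-1$, $\beta=1$, $B=dk-\binom k2$ is obtained by encoding $B$ message symbols with a scalar MDS code of length $\binom n2$ and dimension $B$, placing the code symbols on distinct edges of the complete graph on $n$ vertices, and letting each vertex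 (node) store the symbols on its incident edges. Locality. $\mathcal{C}$ has exact $(r,\delta)$ information locality if there are sets $S_i\subseteq[n]$, $i\in\mathcal{L}$, with $|S_i|=r+\delta-1$, $d_{\min}(\mathcal{C}|_{S_i})=\delta$ and $\mathrm{Rank}(G|_{\cup_iS_i})=K$. Such a code is an MBR-local code with $(r,\delta)$ information locality if it can be punctured to yield $m$ local codes $\mathcal{C}|_{S_i}$, each an $(n_L,r,d)$-MBR code with $n_L=r+\delta-1$, with $\mathrm{Rank}(G|_{\cup_{i=1}^mS_i})=K$. Pyramid code used here. Start from a systematic $[mK_L+\Delta_L-1+\Delta\alpha,\ mK_L,\ \Delta_L+\Delta\alpha]$ MDS code with generator matrix $[\,I\mid Q\mid Q'\,]$, $Q$ having $\Delta_L-1$ columns and $Q'$ having $\Delta\alpha$ columns; partition the rows of $Q$ into $m$ consecutive blocks $Q_1,\dots,Q_m$ of $K_L$ rows each. The pyramid code $\mathcal{A}$ has generator matrix $[\,\mathrm{diag}([I_{K_L}\mid Q_1],\dots,[I_{K_L}\mid Q_m])\mid Q'\,]$. Its $i$-th local code $\mathcal{A}_i$ is generated by $[I_{K_L}\mid Q_i]$, and its global parity symbols are those corresponding to the columns of $Q'$. *)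

theory Defs
  imports
    "Jordan_Normal_Form.DL_Rank"
    "Jordan_Normal_Form.DL_Submatrix"
    "HOL-Library.Disjoint_Sets"
begin

section \<open>Linear codes\<close>

text \<open>
  A linear code of length \<open>N\<close> is a subspace of \<open>F\<^sup>N\<close>. A vector code of block length \<open>n\<close> and
  vector-size parameter \<open>\<alpha>\<close> is represented by its expanded scalar code: a codeword of
  \<open>(F\<^sup>\<alpha>)\<^sup>n\<close> is a vector of length \<open>n * \<alpha>\<close> whose \<open>i\<close>-th vector symbol occupies the coordinates
  \<open>i * \<alpha>, \<dots>, i * \<alpha> + \<alpha> - 1\<close>. All indices (coordinates, nodes, local codes) start at \<open>0\<close>.
  Scalar codes are the case \<open>\<alpha> = 1\<close>.
\<close>

definition linear_code :: "nat \<Rightarrow> 'a::field vec set \<Rightarrow> bool" where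
  "linear_code N C \<longleftrightarrow> VectorSpace.subspace class_ring C (module_vec TYPE('a) N)"

definition code_dim :: "nat \<Rightarrow> 'a::field vec set \<Rightarrow> nat" where
  "code_dim N C = vectorspace.dim class_ring ((module_vec TYPE('a) N)\<lparr>carrier := C\<rparr>)"

definition generator_matrix :: "nat \<Rightarrow> 'a::field vec set \<Rightarrow> 'a mat \<Rightarrow> bool" where
  "generator_matrix N C G \<longleftrightarrow>
     G \<in> carrier_mat (code_dim N C) N \<and> vec_space.row_space N G = C"

definition vsymbol :: "nat \<Rightarrow> 'a vec \<Rightarrow> nat \<Rightarrow> 'a vec" where
  "vsymbol \<alpha> c i = vec \<alpha> (\<lambda>j. c $ (i * \<alpha> + j))"

definition hamming_weight :: "nat \<Rightarrow> nat \<Rightarrow> 'a::zero vec \<Rightarrow> nat" where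
  "hamming_weight n \<alpha> c = card {i. i < n \<and> vsymbol \<alpha> c i \<noteq> 0\<^sub>v \<alpha>}"

definition min_dist :: "nat \<Rightarrow> nat \<Rightarrow> 'a::zero vec set \<Rightarrow> nat" where
  "min_dist n \<alpha> C = Min {hamming_weight n \<alpha> c | c. c \<in> C \<and> c \<noteq> 0\<^sub>v (n * \<alpha>)}"

definition mds_code :: "nat \<Rightarrow> nat \<Rightarrow> 'a::field vec set \<Rightarrow> bool" where
  "mds_code N K C \<longleftrightarrow> linear_code N C \<and> code_dim N C = K \<and> min_dist N 1 C = N - K + 1"


section \<open>Vector codes and restriction to vector symbols\<close>

definition thick_coords :: "nat \<Rightarrow> nat set \<Rightarrow> nat set" where
  "thick_coords \<alpha> S = (\<Union>i\<in>S. {i * \<alpha>..<i * \<alpha> + \<alpha>})"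

text \<open>The coordinates are kept in increasing order, as in \<^const>\<open>submatrix\<close>.\<close>

definition subvector :: "'a vec \<Rightarrow> nat set \<Rightarrow> 'a vec" where
  "subvector c J = vec (card {j. j < dim_vec c \<and> j \<in> J}) (\<lambda>j. c $ pick J j)"

definition code_restrict :: "nat \<Rightarrow> 'a vec set \<Rightarrow> nat set \<Rightarrow> 'a vec set" where
  "code_restrict \<alpha> C S = (\<lambda>c. subvector c (thick_coords \<alpha> S)) ` C"

definition mat_restrict :: "nat \<Rightarrow> 'a mat \<Rightarrow> nat set \<Rightarrow> 'a mat" where
  "mat_restrict \<alpha> G S = submatrix G UNIV (thick_coords \<alpha> S)"

definition mat_rank :: "'a::field mat \<Rightarrow> nat" where
  "mat_rank A = vec_space.rank (dim_row A) A"

text \<open>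
  The last conjunct is the standing assumption on thick columns; it does not depend on the
  choice of the generator matrix.
\<close>

definition vector_code :: "nat \<Rightarrow> nat \<Rightarrow> 'a::field vec set \<Rightarrow> bool" where
  "vector_code n \<alpha> C \<longleftrightarrow>
     linear_code (n * \<alpha>) C \<and>
     (\<exists>G. generator_matrix (n * \<alpha>) C G \<and>
        (\<forall>i<n. inj_on (col G) (thick_coords \<alpha> {i}) \<and>
               \<not> module.lin_dep class_ring (module_vec TYPE('a) (dim_row G))
                    (col G ` thick_coords \<alpha> {i})))"


section \<open>Regenerating codes\<close>

text \<open>The linear maps \<open>F\<^sup>\<alpha> \<rightarrow> F\<^sup>\<beta>\<close> applied by the helper nodes are given by matrices.\<close>

definition regenerating_code ::
  "nat \<Rightarrow> nat \<Rightarrow> nat \<Rightarrow> nat \<Rightarrow> nat \<Rightarrow> nat \<Rightarrow> 'a::field vec set \<Rightarrow> bool" where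
  "regenerating_code n k d \<alpha> \<beta> B C \<longleftrightarrow>
     k \<le> d \<and> d \<le> n - 1 \<and>
     vector_code n \<alpha> C \<and> code_dim (n * \<alpha>) C = B \<and>
     (\<forall>T. T \<subseteq> {..<n} \<and> card T = k \<longrightarrow>
        (\<forall>c\<in>C. \<forall>c'\<in>C. (\<forall>h\<in>T. vsymbol \<alpha> c h = vsymbol \<alpha> c' h) \<longrightarrow> c = c')) \<and>
     (\<forall>i<n. \<forall>D. D \<subseteq> {..<n} - {i} \<and> card D = d \<longrightarrow>
        (\<exists>\<phi> :: nat \<Rightarrow> 'a mat. (\<forall>h\<in>D. \<phi> h \<in> carrier_mat \<beta> \<alpha>) \<and>
           (\<forall>c\<in>C. \<forall>c'\<in>C.
              (\<forall>h\<in>D. \<phi> h *\<^sub>v vsymbol \<alpha> c h = \<phi> h *\<^sub>v vsymbol \<alpha> c' h) \<longrightarrow>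
              vsymbol \<alpha> c i = vsymbol \<alpha> c' i)))"

definition mbr_code ::
  "nat \<Rightarrow> nat \<Rightarrow> nat \<Rightarrow> nat \<Rightarrow> nat \<Rightarrow> nat \<Rightarrow> 'a::field vec set \<Rightarrow> bool" where
  "mbr_code n k d \<alpha> \<beta> B C \<longleftrightarrow>
     regenerating_code n k d \<alpha> \<beta> B C \<and> \<alpha> = d * \<beta> \<and> B = (\<Sum>i<k. (d - i) * \<beta>)"

definition complete_graph_edges :: "nat \<Rightarrow> nat set set" where
  "complete_graph_edges n = {e. e \<subseteq> {..<n} \<and> card e = 2}"

text \<open>
  \<open>place s\<close> is the edge of the complete graph on \<open>{..<n}\<close> carrying the \<open>s\<close>-th code symbol, and
  \<open>slot v\<close> lists, in an arbitrary order, the indices of the \<open>n - 1\<close> code symbols on the edges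
  incident to the vertex \<open>v\<close>.
\<close>

definition edge_placement :: "nat \<Rightarrow> (nat \<Rightarrow> nat set) \<Rightarrow> (nat \<Rightarrow> nat \<Rightarrow> nat) \<Rightarrow> bool" where
  "edge_placement n place slot \<longleftrightarrow>
     bij_betw place {..<n choose 2} (complete_graph_edges n) \<and>
     (\<forall>v<n. bij_betw (slot v) {..<n - 1} {s. s < n choose 2 \<and> v \<in> place s})"

definition store_on_nodes :: "nat \<Rightarrow> (nat \<Rightarrow> nat \<Rightarrow> nat) \<Rightarrow> 'a vec \<Rightarrow> 'a vec" where
  "store_on_nodes n slot c = vec (n * (n - 1)) (\<lambda>p. c $ slot (p div (n - 1)) (p mod (n - 1)))"

definition repair_by_transfer ::
  "nat \<Rightarrow> nat \<Rightarrow> nat \<Rightarrow> nat \<Rightarrow> nat \<Rightarrow> nat \<Rightarrow> 'a::field vec set \<Rightarrow> bool" where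
  "repair_by_transfer n k d \<alpha> \<beta> B C \<longleftrightarrow>
     d = n - 1 \<and> \<alpha> = n - 1 \<and> \<beta> = 1 \<and> B = d * k - (k choose 2) \<and>
     (\<exists>M place slot. mds_code (n choose 2) B M \<and> edge_placement n place slot \<and>
        C = store_on_nodes n slot ` M)"


section \<open>Locality\<close>

text \<open>
  The sets \<open>S i\<close>, \<open>i \<in> L\<close>, supporting the local codes are an explicit argument. The rank
  condition does not depend on the choice of the generator matrix.
\<close>

definition exact_information_locality ::
  "nat \<Rightarrow> nat \<Rightarrow> nat \<Rightarrow> nat \<Rightarrow> nat set \<Rightarrow> (nat \<Rightarrow> nat set) \<Rightarrow> 'a::field vec set \<Rightarrow> bool" where
  "exact_information_locality n \<alpha> r \<delta> L S C \<longleftrightarrow>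
     vector_code n \<alpha> C \<and>
     (\<forall>i\<in>L. S i \<subseteq> {..<n} \<and> card (S i) = r + \<delta> - 1 \<and>
        min_dist (r + \<delta> - 1) \<alpha> (code_restrict \<alpha> C (S i)) = \<delta>) \<and>
     (\<forall>G. generator_matrix (n * \<alpha>) C G \<longrightarrow>
        mat_rank (mat_restrict \<alpha> G (\<Union>i\<in>L. S i)) = code_dim (n * \<alpha>) C)"

definition mbr_local_code ::
  "nat \<Rightarrow> nat \<Rightarrow> nat \<Rightarrow> nat \<Rightarrow> nat \<Rightarrow> nat \<Rightarrow> nat \<Rightarrow> (nat \<Rightarrow> nat set) \<Rightarrow> 'a::field vec set \<Rightarrow> bool"
  where
  "mbr_local_code n \<alpha> \<beta> r \<delta> d m S C \<longleftrightarrow>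
     exact_information_locality n \<alpha> r \<delta> {..<m} S C \<and>
     (\<forall>i<m. \<exists>B. mbr_code (r + \<delta> - 1) r d \<alpha> \<beta> B (code_restrict \<alpha> C (S i)))"


section \<open>Pyramid codes\<close>

definition hcat :: "'a mat \<Rightarrow> 'a mat \<Rightarrow> 'a mat" where
  "hcat A B = mat (dim_row A) (dim_col A + dim_col B)
     (\<lambda>(i, j). if j < dim_col A then A $$ (i, j) else B $$ (i, j - dim_col A))"

definition row_block :: "nat \<Rightarrow> 'a mat \<Rightarrow> nat \<Rightarrow> 'a mat" where
  "row_block K Q i = mat K (dim_col Q) (\<lambda>(a, b). Q $$ (i * K + a, b))"

definition pyramid_matrix :: "nat \<Rightarrow> nat \<Rightarrow> 'a::{zero,one} mat \<Rightarrow> 'a mat \<Rightarrow> 'a mat" where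
  "pyramid_matrix m K Q Q' =
     hcat (diag_block_mat (map (\<lambda>i. hcat (1\<^sub>m K) (row_block K Q i)) [0..<m])) Q'"

text \<open>
  \<open>t\<close> is the number of global parity symbols. The underlying systematic MDS code has length
  \<open>m * K + D - 1 + t\<close> and dimension \<open>m * K\<close>, hence minimum distance \<open>D + t\<close>. The \<open>i\<close>-th local
  code occupies the coordinates \<open>i * (K + D - 1), \<dots>, (i + 1) * (K + D - 1) - 1\<close> and the
  global parities occupy the last \<open>t\<close> coordinates.
\<close>

definition pyramid_code :: "nat \<Rightarrow> nat \<Rightarrow> nat \<Rightarrow> nat \<Rightarrow> 'a::field vec set \<Rightarrow> bool" where
  "pyramid_code m K D t A \<longleftrightarrow>
     (\<exists>Q \<in> carrier_mat (m * K) (D - 1). \<exists>Q' \<in> carrier_mat (m * K) t.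
        mds_code (m * K + D - 1 + t) (m * K)
          (vec_space.row_space (m * K + D - 1 + t) (hcat (hcat (1\<^sub>m (m * K)) Q) Q')) \<and>
        A = vec_space.row_space (m * (K + D - 1) + t) (pyramid_matrix m K Q Q'))"

text \<open>
  The nodes \<open>i * n, \<dots>, i * n + n - 1\<close> hold the \<open>n choose 2\<close> symbols of the \<open>i\<close>-th local code,
  stored via \<open>slot i\<close>; the node \<open>m * n + g\<close> holds the global parities with indices \<open>grp (g, j)\<close>,
  \<open>j < n - 1\<close>, counted from the first global parity.
\<close>

definition pyramid_store ::
  "nat \<Rightarrow> nat \<Rightarrow> nat \<Rightarrow> (nat \<Rightarrow> nat \<Rightarrow> nat \<Rightarrow> nat) \<Rightarrow> (nat \<times> nat \<Rightarrow> nat) \<Rightarrow> 'a vec \<Rightarrow> 'a vec" where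
  "pyramid_store n m g slot grp c =
     vec ((m * n + g) * (n - 1))
       (\<lambda>p. let v = p div (n - 1); j = p mod (n - 1) in
          if v < m * n
          then c $ ((v div n) * (n choose 2) + slot (v div n) (v mod n) j)
          else c $ (m * (n choose 2) + grp (v - m * n, j)))"

end

theory Submission
  imports Defs "HOL-Library.Cardinality"
begin

text \<open>
  The edges carrying the nonzero symbols of a local code join nodes that are themselves nonzero, so a
  local word with \<open>l\<close> nonzero nodes has at most \<open>l choose 2\<close> nonzero symbols. As the local code is MDS
  with distance \<open>(\<delta> - 1 choose 2) + 1\<close>, at least \<open>\<delta>\<close> nodes of a nonzero local word are nonzero; the
  \<open>K\<^sub>L\<close> edges touching \<open>r\<close> nodes form an information set, and those touching \<open>r - 1\<close> nodes are fewer
  than \<open>K\<^sub>L\<close>, so that some nonzero word vanishes on them. Globally, the pyramid code has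
  distance \<open>\<Delta>\<^sub>L + \<Delta> * \<alpha>\<close>, and replacing a global node by a local one adds at most \<open>\<alpha>\<close> edges, so at most
  \<open>\<Delta> + \<delta> - 1\<close> nodes never carry that many nonzero symbols. Over a finite field a code of dimension \<open>k\<close>
  has \<open>q ^ k\<close> words, so dimension and rank arguments reduce to the pigeonhole principle.
\<close>

section \<open>Linear codes over a finite field\<close>

text \<open>\<open>A\<close> is given by its pyramid matrix alone, so its dimension, its distance
  and the MDS property of its local codes have to be derived. The bridge is the systematic MDS code
  before its parities were split: a pyramid word and its partner there share a message, and each
  parity of the partner that was split is the sum of its local pieces. A nonzero sum has a nonzero
  summand, so splitting cannot lower the weight. The constant \<open>\<delta> - 1 choose 2\<close>
  arises because \<open>K\<^sub>L\<close> is the number of edges that meet \<open>r\<close> fixed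
  nodes of a local graph; the edges left over are those among the other \<delta> - 1 nodes. A
  separate obstacle is the standing assumption that the thick columns are independent. It is met by
  dual words: for each symbol of a node, a codeword that is nonzero there and zero at the other
  symbols of the node. MDS codes supply them because a node holds
  \<open>n\<^sub>L - 1 \<le> K\<^sub>L\<close> distinct symbols. Storage writes every local symbol
  to two nodes, so puncturing, restriction and storage are treated alike, as reading a word along a
  coordinate map that may repeat.\<close>

lemma linear_code_iff:
  "linear_code N (C :: 'a::field vec set) \<longleftrightarrow>
     C \<subseteq> carrier_vec N \<and> 0\<^sub>v N \<in> C \<and> (\<forall>c\<in>C. \<forall>c'\<in>C. c + c' \<in> C) \<and> (\<forall>a. \<forall>c\<in>C. a \<cdot>\<^sub>v c \<in> C)"
proof -
  interpret vec_space "TYPE('a)" N .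
  show ?thesis
    unfolding linear_code_def VectorSpace.subspace_def submodule_def
    using vec_vs[where 'a='a and n=N] vec_module[where 'a='a and n=N]
    by (simp add: module_vec_simps class_ring_simps) blast
qed

text \<open>Independent subsets of \<open>C\<close> have at most \<open>N\<close> elements, so a
  maximal one exists, and it is a basis of the carrier-restricted module that
  \<open>code_dim\<close> measures. Independence and span agree there with those of the ambient
  space, in which later arguments take place.\<close>

lemma code_basis:
  fixes C :: "'a::field vec set"
  assumes "linear_code N C"
  obtains bs where "set bs \<subseteq> C" "distinct bs" "length bs = code_dim N C"
    "\<not> module.lin_dep class_ring (module_vec TYPE('a) N) (set bs)"
    "LinearCombinations.module.span class_ring (module_vec TYPE('a) N) (set bs) = C"
proof -
  interpret vec_space "TYPE('a)" N .
  have sub: "VectorSpace.subspace class_ring C V" using assms unfolding linear_code_def .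
  have smod: "submodule class_ring C V" using sub unfolding VectorSpace.subspace_def by simp
  have vsC: "vectorspace class_ring (vs C)" using subspace_is_vs[OF sub] .
  have Csub: "C \<subseteq> carrier_vec N" using assms by (simp add: linear_code_iff)
  have indep_iff: "module.lin_dep class_ring (vs C) B = lin_dep B" if "B \<subseteq> C" for B
    using span_li_not_depend(2)[OF that smod] by simp
  have span_iff: "LinearCombinations.module.span class_ring (vs C) B = span B" if "B \<subseteq> C" for B
    using span_li_not_depend(1)[OF that smod] by simp
  have "\<exists>A. finite A \<and> maximal A (\<lambda>T. T \<subseteq> C \<and> lin_indpt T)"
  proof (rule maximal_exists)
    fix A assume "A \<subseteq> C \<and> lin_indpt A"
    then show "finite A \<and> card A \<le> N"
      using li_le_dim[OF fin_dim, of A] Csub dim_is_n by auto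
  next
    show "{} \<subseteq> C \<and> lin_indpt {}" using finite_lin_indpt2[of "{}"] by auto
  qed
  then obtain B where B: "finite B" "maximal B (\<lambda>T. T \<subseteq> C \<and> lin_indpt T)" by blast
  have BC: "B \<subseteq> C" "lin_indpt B" using B(2) unfolding maximal_def by auto
  have "maximal B (\<lambda>T. T \<subseteq> carrier (vs C) \<and> \<not> module.lin_dep class_ring (vs C) T)"
    using B(2) indep_iff unfolding maximal_def by (simp) (metis indep_iff)
  then have basis: "vectorspace.basis class_ring (vs C) B"
    using vectorspace.max_li_is_basis[OF vsC] by blast
  have "vectorspace.dim class_ring (vs C) = card B"
    using vectorspace.dim_basis[OF vsC B(1) basis] .
  then have dim: "code_dim N C = card B" unfolding code_dim_def by simp
  have "span B = C"
    using basis span_iff[OF BC(1)] unfolding vectorspace.basis_def[OF vsC] by auto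
  moreover obtain bs where "set bs = B" "distinct bs"
    using finite_distinct_list[OF B(1)] by blast
  ultimately show thesis using that[of bs] BC dim distinct_card[of bs] by auto
qed

lemma minus_vec_eq_0D:
  fixes u v :: "'a::ab_group_add vec"
  assumes "u \<in> carrier_vec k" "v \<in> carrier_vec k" "u - v = 0\<^sub>v k"
  shows "u = v"
proof (rule eq_vecI)
  fix i assume "i < dim_vec v"
  then have i: "i < k" using assms by auto
  have "(u - v) $ i = 0\<^sub>v k $ i" using assms(3) by simp
  then show "u $ i = v $ i" using assms(1,2) i by auto
qed (use assms in auto)


section \<open>Counting vectors, messages and codewords\<close>

lemma card_carrier_vec: "card (carrier_vec k :: 'q::finite vec set) = CARD('q) ^ k"
proof -
  have eq: "carrier_vec k = vec_of_list ` {xs :: 'q list. set xs \<subseteq> UNIV \<and> length xs = k}" (is "_ = _ ` ?L")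
  proof
    show "carrier_vec k \<subseteq> vec_of_list ` ?L"
    proof
      fix v :: "'q vec" assume "v \<in> carrier_vec k"
      then show "v \<in> vec_of_list ` ?L" by (intro image_eqI[of _ _ "list_of_vec v"]) (auto simp: vec_list)
    qed
  qed (auto simp: carrier_vecI)
  have "inj_on vec_of_list ?L" by (metis inj_onI list_vec)
  then show ?thesis unfolding eq using card_lists_length_eq[of "UNIV :: 'q set" k] by (simp add: card_image)
qed

lemma finite_carrier_vec: "finite (carrier_vec k :: 'q::finite vec set)"
  by (rule card_ge_0_finite) (simp add: card_carrier_vec)

lemma row_space_carrier:
  fixes G :: "'a::field mat"
  assumes "G \<in> carrier_mat k N"
  shows "vec_space.row_space N G = (\<lambda>u. transpose_mat G *\<^sub>v u) ` carrier_vec k"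
  using vec_space.row_space_eq[OF assms] assms by (auto simp: image_iff)

lemma generator_matrix_image:
  fixes C :: "'a::field vec set"
  assumes "generator_matrix N C G"
  shows "(\<lambda>u. transpose_mat G *\<^sub>v u) ` carrier_vec (code_dim N C) = C"
  using assms row_space_carrier[of G "code_dim N C" N] unfolding generator_matrix_def by simp

lemma linear_code_mult_image:
  fixes M :: "'a::field mat"
  assumes "M \<in> carrier_mat N k"
  shows "linear_code N ((\<lambda>u. M *\<^sub>v u) ` carrier_vec k)"
  unfolding linear_code_iff
proof (intro conjI ballI allI)
  show "0\<^sub>v N \<in> (\<lambda>u. M *\<^sub>v u) ` carrier_vec k"
    using assms by (intro image_eqI[of _ _ "0\<^sub>v k"]) auto
next
  fix c c' assume "c \<in> (\<lambda>u. M *\<^sub>v u) ` carrier_vec k" "c' \<in> (\<lambda>u. M *\<^sub>v u) ` carrier_vec k"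
  then obtain u u' where "u \<in> carrier_vec k" "u' \<in> carrier_vec k" "c = M *\<^sub>v u" "c' = M *\<^sub>v u'" by auto
  then show "c + c' \<in> (\<lambda>u. M *\<^sub>v u) ` carrier_vec k"
    using assms by (intro image_eqI[of _ _ "u + u'"]) (auto simp: mult_add_distrib_mat_vec)
next
  fix a c assume "c \<in> (\<lambda>u. M *\<^sub>v u) ` carrier_vec k"
  then obtain u where "u \<in> carrier_vec k" "c = M *\<^sub>v u" by auto
  then show "a \<cdot>\<^sub>v c \<in> (\<lambda>u. M *\<^sub>v u) ` carrier_vec k"
    using assms by (intro image_eqI[of _ _ "a \<cdot>\<^sub>v u"]) (auto simp: mult_mat_vec)
qed (use assms in auto)

lemma linear_code_row_space:
  fixes G :: "'a::field mat"
  assumes "G \<in> carrier_mat k N"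
  shows "linear_code N (vec_space.row_space N G)"
  unfolding row_space_carrier[OF assms] using linear_code_mult_image[of "transpose_mat G" N k] assms by simp

lemma linear_codeD:
  fixes C :: "'a::field vec set"
  assumes "linear_code N C"
  shows "C \<subseteq> carrier_vec N" "0\<^sub>v N \<in> C" "c \<in> C \<Longrightarrow> c' \<in> C \<Longrightarrow> c + c' \<in> C"
    "c \<in> C \<Longrightarrow> a \<cdot>\<^sub>v c \<in> C"
  using assms unfolding linear_code_iff by simp_all

lemma linear_code_diff:
  fixes C :: "'a::field vec set"
  assumes "linear_code N C" "c \<in> C" "c' \<in> C"
  shows "c - c' \<in> C"
proof -
  have car: "c \<in> carrier_vec N" "c' \<in> carrier_vec N" using assms linear_codeD(1) by blast+
  have "c - c' = c + (-1) \<cdot>\<^sub>v c'" using car by (intro eq_vecI) auto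
  then show ?thesis using linear_codeD(3)[OF assms(1,2) linear_codeD(4)[OF assms(1,3)]] by simp
qed

text \<open>The rows are a basis of \<open>C\<close>; their independence gives the injective encoder
  on which the counting of codewords rests.\<close>

lemma generator_matrix_exists:
  fixes C :: "'a::field vec set"
  assumes lin: "linear_code N C"
  obtains G where "generator_matrix N C G"
    "inj_on (\<lambda>u. transpose_mat G *\<^sub>v u) (carrier_vec (code_dim N C))"
proof -
  interpret vec_space "TYPE('a)" N .
  obtain bs where bs: "set bs \<subseteq> C" "distinct bs" "length bs = code_dim N C" "lin_indpt (set bs)" "span (set bs) = C"
    using code_basis[OF lin] by blast
  have Csub: "C \<subseteq> carrier_vec N" by (rule linear_codeD(1)[OF lin])
  have bsc: "set bs \<subseteq> carrier_vec N" using bs(1) Csub by auto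
  define G where "G = mat_of_rows N bs"
  define k where "k = code_dim N C"
  have G: "G \<in> carrier_mat k N" unfolding G_def k_def using bs(3) by auto
  have rows: "rows G = bs" unfolding G_def using bsc by simp
  have "row_space G = C" unfolding row_space_def rows bs(5) ..
  then have gen: "generator_matrix N C G" using G by (simp add: generator_matrix_def k_def)
  have GT: "transpose_mat G \<in> carrier_mat N k" using G by simp
  have cols: "cols (transpose_mat G) = bs" using rows by simp
  have ker: "u = 0\<^sub>v k" if "u \<in> carrier_vec k" "transpose_mat G *\<^sub>v u = 0\<^sub>v N" for u
    using lin_depI[OF GT that(1) _ that(2)] bs cols by auto
  have "inj_on (\<lambda>u. transpose_mat G *\<^sub>v u) (carrier_vec k)"
  proof (rule inj_onI)
    fix u u' assume u: "u \<in> carrier_vec k" "u' \<in> carrier_vec k"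
      and eq: "transpose_mat G *\<^sub>v u = transpose_mat G *\<^sub>v u'"
    have "transpose_mat G *\<^sub>v (u - u') = 0\<^sub>v N"
      unfolding mult_minus_distrib_mat_vec[OF GT u] eq by (rule minus_cancel_vec[OF mult_mat_vec_carrier[OF GT u(2)]])
    then have "u - u' = 0\<^sub>v k" using ker u by simp
    then show "u = u'" using minus_vec_eq_0D u by blast
  qed
  then show thesis using that gen unfolding k_def by blast
qed

lemma card_code:
  fixes C :: "'q::{field,finite} vec set"
  assumes "linear_code N C"
  shows "card C = CARD('q) ^ code_dim N C"
proof -
  obtain G where G: "generator_matrix N C G"
    "inj_on (\<lambda>u. transpose_mat G *\<^sub>v u) (carrier_vec (code_dim N C))"
    using generator_matrix_exists[OF assms] .
  then show ?thesis using card_image[OF G(2)] generator_matrix_image[OF G(1)] by (simp add: card_carrier_vec)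
qed

lemma one_less_card_field: "1 < CARD('q::{field,finite})"
proof -
  have "card {0, 1 :: 'q} \<le> CARD('q)" by (rule card_mono) auto
  then show ?thesis by simp
qed

lemma code_dim_eqI:
  fixes C :: "'q::{field,finite} vec set"
  assumes "linear_code N C" "card C = CARD('q) ^ k"
  shows "code_dim N C = k"
  using card_code[OF assms(1)] assms(2) power_inject_exp[OF one_less_card_field[where 'q='q]] by metis

text \<open>A generator matrix has \<open>code_dim N C\<close> rows, so encoding maps onto
  \<open>C\<close> from a set of the same finite size, and surjectivity forces injectivity. This
  covers every generator matrix, not only one built from a basis.\<close>

lemma generator_matrix_inj:
  fixes C :: "'q::{field,finite} vec set"
  assumes lin: "linear_code N C" and G: "generator_matrix N C G"
  shows "inj_on (\<lambda>u. transpose_mat G *\<^sub>v u) (carrier_vec (code_dim N C))"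
proof (rule eq_card_imp_inj_on)
  show "card ((\<lambda>u. transpose_mat G *\<^sub>v u) ` carrier_vec (code_dim N C)) = card (carrier_vec (code_dim N C) :: 'q vec set)"
    using card_code[OF lin] generator_matrix_image[OF G] by (simp add: card_carrier_vec)
qed (rule finite_carrier_vec)

text \<open>The words of \<open>C\<close> outnumber the value patterns on \<open>J\<close>, so two
  words agree there and their difference is the witness.\<close>

lemma exists_codeword_vanishing:
  fixes C :: "'q::{field,finite} vec set"
  assumes lin: "linear_code N C" and J: "finite J" "card J < code_dim N C"
  obtains c where "c \<in> C" "c \<noteq> 0\<^sub>v N" "\<And>j. j \<in> J \<Longrightarrow> j < N \<Longrightarrow> c $ j = 0"
proof -
  let ?J = "J \<inter> {..<N}"
  \<comment> \<open>\<open>restrict\<close> normalizes the pattern off \<open>?J\<close>, so that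
    all patterns lie in a finite extensional function space of known size.\<close>
  let ?f = "\<lambda>c :: 'q vec. restrict (\<lambda>j. c $ j) ?J"
  have Csub: "C \<subseteq> carrier_vec N" by (rule linear_codeD(1)[OF lin])
  have "card (?f ` C) \<le> card (?J \<rightarrow>\<^sub>E (UNIV :: 'q set))"
    using J by (intro card_mono finite_PiE) (auto simp: PiE_iff extensional_def split: if_splits)
  also have "\<dots> = CARD('q) ^ card ?J" using J by (simp add: card_PiE)
  also have "\<dots> \<le> CARD('q) ^ card J"
    using J one_less_card_field[where 'q='q] by (intro power_increasing card_mono) auto
  also have "\<dots> < CARD('q) ^ code_dim N C"
    using J(2) one_less_card_field[where 'q='q] by (intro power_strict_increasing) auto
  also have "\<dots> = card C" using card_code[OF lin] by simp
  finally have "\<not> inj_on ?f C" using card_image by fastforce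
  then obtain c c' where cc: "c \<in> C" "c' \<in> C" "c \<noteq> c'" "?f c = ?f c'" unfolding inj_on_def by blast
  have car: "c \<in> carrier_vec N" "c' \<in> carrier_vec N" using cc Csub by auto
  show thesis
  proof (rule that)
    show "c - c' \<in> C" by (rule linear_code_diff[OF lin cc(1,2)])
    show "c - c' \<noteq> 0\<^sub>v N"
    using minus_vec_eq_0D[OF car] cc(3) by blast
    fix j assume j: "j \<in> J" "j < N"
    then have "?f c j = ?f c' j" using cc(4) by simp
    then show "(c - c') $ j = 0" using j car by simp
  qed
qed

section \<open>Independence of columns and rank of submatrices\<close>

lemma mult_transpose_index:
  fixes G :: "'a::comm_semiring_0 mat"
  assumes "G \<in> carrier_mat k N" "u \<in> carrier_vec k" "j < N"
  shows "(transpose_mat G *\<^sub>v u) $ j = (\<Sum>i<k. G $$ (i, j) * u $ i)"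
  using assms by (auto simp: scalar_prod_def atLeast0LessThan intro!: sum.cong)

text \<open>A word that is nonzero at \<open>j\<close> and zero on the rest of \<open>J\<close>
  comes from a message orthogonal to all columns of \<open>J\<close> but the \<open>j\<close>-th.
  Pairing a vanishing combination of columns with this message isolates one coefficient. Injectivity
  of \<open>col G\<close> is a separate conclusion because \<open>lin_dep\<close> speaks of the set
  of columns and does not see repetitions.\<close>

lemma generator_matrix_columns_independent:
  fixes C :: "'a::field vec set"
  assumes G: "generator_matrix N C G" and J: "J \<subseteq> {..<N}"
    and dual: "\<And>j. j \<in> J \<Longrightarrow> \<exists>c\<in>C. c $ j \<noteq> 0 \<and> (\<forall>j'\<in>J. j' \<noteq> j \<longrightarrow> c $ j' = 0)"
  shows "inj_on (col G) J"
    and "\<not> module.lin_dep class_ring (module_vec TYPE('a) (dim_row G)) (col G ` J)"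
proof -
  define k where "k = code_dim N C"
  have Gc: "G \<in> carrier_mat k N" using G unfolding generator_matrix_def k_def by simp
  have dual': "\<exists>u\<in>carrier_vec k. col G j \<bullet> u \<noteq> 0 \<and> (\<forall>j'\<in>J. j' \<noteq> j \<longrightarrow> col G j' \<bullet> u = 0)"
    if j: "j \<in> J" for j
  proof -
    obtain c where c: "c \<in> C" "c $ j \<noteq> 0" "\<forall>j'\<in>J. j' \<noteq> j \<longrightarrow> c $ j' = 0" using dual[OF j] by blast
    obtain u where u: "u \<in> carrier_vec k" "c = transpose_mat G *\<^sub>v u"
      using c(1) generator_matrix_image[OF G] unfolding k_def by blast
    have "c $ j' = col G j' \<bullet> u" if "j' \<in> J" for j'
      using that J Gc u by auto
    then show ?thesis using c(2,3) u(1) j by auto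
  qed
  show "inj_on (col G) J"
  proof (rule inj_onI, rule ccontr)
    fix j j' assume jj: "j \<in> J" "j' \<in> J" "col G j = col G j'" "j \<noteq> j'"
    from dual'[OF jj(1)] obtain u where "col G j \<bullet> u \<noteq> 0" "\<forall>j'\<in>J. j' \<noteq> j \<longrightarrow> col G j' \<bullet> u = 0" by blast
    with jj show False by metis
  qed
  have k: "dim_row G = k" using Gc by simp
  interpret vec_space "TYPE('a)" k .
  let ?A = "col G ` J"
  have fin: "finite ?A" using J finite_subset by blast
  have Ac: "?A \<subseteq> carrier_vec k" using Gc by auto
  show "\<not> module.lin_dep class_ring (module_vec TYPE('a) (dim_row G)) ?A"
    unfolding k
  proof
    assume dep: "lin_dep ?A"
    obtain a v where a: "lincomb a ?A = 0\<^sub>v k" "v \<in> ?A" "a v \<noteq> 0"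
      using finite_lin_dep[OF fin dep] Ac by auto
    obtain j where j: "j \<in> J" "v = col G j" using a(2) by blast
    obtain u where u: "u \<in> carrier_vec k" "v \<bullet> u \<noteq> 0" "\<forall>j'\<in>J. j' \<noteq> j \<longrightarrow> col G j' \<bullet> u = 0"
      using dual'[OF j(1)] j(2) by blast
    have z: "w \<bullet> u = 0" if "w \<in> ?A - {v}" for w using that j u(3) by auto
    have "0 = (\<Sum>i<k. lincomb a ?A $ i * u $ i)" unfolding a(1) by simp
    also have "\<dots> = (\<Sum>i<k. (\<Sum>w\<in>?A. a w * w $ i) * u $ i)"
      by (intro sum.cong refl) (simp add: lincomb_index[OF _ Ac])
    also have "\<dots> = (\<Sum>w\<in>?A. \<Sum>i<k. a w * (w $ i * u $ i))"
      unfolding sum_distrib_right by (subst sum.swap) (simp add: mult.assoc)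
    also have "\<dots> = (\<Sum>w\<in>?A. a w * (w \<bullet> u))"
      using u(1) by (simp add: sum_distrib_left scalar_prod_def atLeast0LessThan)
    also have "\<dots> = a v * (v \<bullet> u)"
      using z fin a(2) by (simp add: sum.remove[of _ v])
    finally show False using a(3) u(2) by simp
  qed
qed

text \<open>Trades the standing assumption on thick columns for the existence of dual words, so that
  no generator matrix has to be handled for a concrete code.\<close>

lemma vector_codeI:
  fixes C :: "'a::field vec set"
  assumes lin: "linear_code (n * \<alpha>) C"
    and dual: "\<And>i j. i < n \<Longrightarrow> j < \<alpha> \<Longrightarrow>
      \<exists>c\<in>C. c $ (i * \<alpha> + j) \<noteq> 0 \<and> (\<forall>j'<\<alpha>. j' \<noteq> j \<longrightarrow> c $ (i * \<alpha> + j') = 0)"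
  shows "vector_code n \<alpha> C"
proof -
  obtain G where G: "generator_matrix (n * \<alpha>) C G" using generator_matrix_exists[OF lin] by blast
  have "inj_on (col G) (thick_coords \<alpha> {i}) \<and>
      \<not> module.lin_dep class_ring (module_vec TYPE('a) (dim_row G)) (col G ` thick_coords \<alpha> {i})"
    if i: "i < n" for i
  proof -
    have T: "thick_coords \<alpha> {i} = (\<lambda>j. i * \<alpha> + j) ` {..<\<alpha>}"
      using image_add_atLeastLessThan[of "i * \<alpha>" 0 \<alpha>] by (simp add: thick_coords_def lessThan_atLeast0 add.commute)
    have "Suc i * \<alpha> \<le> n * \<alpha>" using i by (intro mult_le_mono1) simp
    then have sub: "thick_coords \<alpha> {i} \<subseteq> {..<n * \<alpha>}" by (auto simp: thick_coords_def)
    have d: "\<exists>c\<in>C. c $ j \<noteq> 0 \<and> (\<forall>j'\<in>thick_coords \<alpha> {i}. j' \<noteq> j \<longrightarrow> c $ j' = 0)"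
      if j: "j \<in> thick_coords \<alpha> {i}" for j
    proof -
      obtain j0 where j0: "j0 < \<alpha>" "j = i * \<alpha> + j0" using j T by auto
      show ?thesis using dual[OF i j0(1)] unfolding T j0(2) by auto
    qed
    show ?thesis using generator_matrix_columns_independent[OF G sub d] by blast
  qed
  then show ?thesis using lin G unfolding vector_code_def by blast
qed

text \<open>If the column space \<open>V\<close> had dimension \<open>r < k\<close>, its generator
  matrix \<open>H\<close> would map \<open>k\<close>-vectors to \<open>r\<close>-vectors and so, by
  pigeonhole, kill some nonzero \<open>w\<close>. Such a \<open>w\<close> is orthogonal to
  \<open>V\<close>, in particular to every column of \<open>A\<close>, against the trivial left
  kernel.\<close>

lemma mat_rank_eq_dim_row:
  fixes A :: "'q::{field,finite} mat"
  assumes A: "A \<in> carrier_mat k N"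
    and ker: "\<And>u. u \<in> carrier_vec k \<Longrightarrow> transpose_mat A *\<^sub>v u = 0\<^sub>v N \<Longrightarrow> u = 0\<^sub>v k"
  shows "mat_rank A = k"
proof -
  define V where "V = vec_space.col_space k A"
  define r where "r = code_dim k V"
  have V_eq: "V = vec_space.row_space k (transpose_mat A)"
    unfolding V_def by (rule vec_space.col_space_eq_row_space_transpose)
  have lin: "linear_code k V" unfolding V_eq using A by (intro linear_code_row_space) simp
  have "dim_row A = k" using A by simp
  then have rank: "mat_rank A = r"
    unfolding r_def V_def mat_rank_def vec_space.rank_def code_dim_def vec_space.col_space_def by simp
  have colV: "A *\<^sub>v x \<in> V" if "x \<in> carrier_vec N" for x
    unfolding V_eq using that A by (subst row_space_carrier[of _ N]) auto
  have "CARD('q) ^ r \<le> CARD('q) ^ k"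
    using card_code[OF lin] card_mono[OF finite_carrier_vec linear_codeD(1)[OF lin]]
    by (simp add: r_def card_carrier_vec)
  then have "r \<le> k" using power_increasing_iff[OF one_less_card_field[where 'q='q]] by blast
  moreover have "\<not> r < k"
  proof
    assume less: "r < k"
    obtain H where H: "generator_matrix k V H" using generator_matrix_exists[OF lin] by blast
    have Hc: "H \<in> carrier_mat r k" using H unfolding generator_matrix_def r_def by simp
    have "card ((\<lambda>u. H *\<^sub>v u) ` carrier_vec k) \<le> card (carrier_vec r :: 'q vec set)"
      using Hc by (intro card_mono finite_carrier_vec) auto
    also have "\<dots> < card (carrier_vec k :: 'q vec set)"
      unfolding card_carrier_vec by (rule power_strict_increasing[OF less one_less_card_field])
    finally have "\<not> inj_on (\<lambda>u. H *\<^sub>v u) (carrier_vec k)" using card_image by fastforce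
    then obtain u u' where u: "u \<in> carrier_vec k" "u' \<in> carrier_vec k" "u \<noteq> u'" "H *\<^sub>v u = H *\<^sub>v u'"
      unfolding inj_on_def by blast
    define w where "w = u - u'"
    have w: "w \<in> carrier_vec k" "w \<noteq> 0\<^sub>v k" using minus_carrier_vec[OF u(1,2)] minus_vec_eq_0D[OF u(1,2)] u(3) unfolding w_def by auto
    have "H *\<^sub>v w = 0\<^sub>v r"
      unfolding w_def mult_minus_distrib_mat_vec[OF Hc u(1,2)] u(4)
      by (rule minus_cancel_vec[OF mult_mat_vec_carrier[OF Hc u(2)]])
    have orth: "v \<bullet> w = 0" if "v \<in> V" for v
    proof -
      obtain x where x: "x \<in> carrier_vec r" "v = transpose_mat H *\<^sub>v x"
        using \<open>v \<in> V\<close> generator_matrix_image[OF H] unfolding r_def by blast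
      have "v \<bullet> w = x \<bullet> (H *\<^sub>v w)"
        using x transpose_vec_mult_scalar[OF Hc w(1) x(1)] by simp
      then show ?thesis using \<open>H *\<^sub>v w = 0\<^sub>v r\<close> x(1) by simp
    qed
    have "transpose_mat A *\<^sub>v w = 0\<^sub>v N"
    proof (rule eq_vecI)
      fix j assume "j < dim_vec (0\<^sub>v N :: 'q vec)"
      then have j: "j < N" by simp
      have "col A j = A *\<^sub>v unit_vec N j"
        using A j by (intro eq_vecI) (simp_all add: scalar_prod_right_unit)
      then have "col A j \<in> V" using colV by simp
      then have "col A j \<bullet> w = 0" by (rule orth)
      then show "(transpose_mat A *\<^sub>v w) $ j = 0\<^sub>v N $ j" using j A by simp
    qed (use A in simp)
    then show False using ker[OF w(1)] w(2) by simp
  qed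
  ultimately show ?thesis using rank by simp
qed

text \<open>A left kernel vector of the submatrix is a message whose codeword vanishes on
  \<open>J\<close>. If only the zero word does so, injectivity of the encoder makes the message
  zero. The rank condition of locality thus becomes a statement about words.\<close>

lemma mat_rank_submatrix_eq_code_dim:
  fixes C :: "'q::{field,finite} vec set"
  assumes lin: "linear_code N C" and G: "generator_matrix N C G"
    and inj: "\<And>c. c \<in> C \<Longrightarrow> (\<And>j. j \<in> J \<Longrightarrow> j < N \<Longrightarrow> c $ j = 0) \<Longrightarrow> c = 0\<^sub>v N"
  shows "mat_rank (submatrix G UNIV J) = code_dim N C"
proof -
  define k where "k = code_dim N C"
  let ?A = "submatrix G UNIV J" and ?N = "card {j. j < N \<and> j \<in> J}"
  have Gc: "G \<in> carrier_mat k N" using G unfolding generator_matrix_def k_def by simp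
  have A: "?A \<in> carrier_mat k ?N" using Gc by (auto simp: dim_submatrix)
  have "mat_rank ?A = k"
  proof (rule mat_rank_eq_dim_row[OF A])
    fix u assume u: "u \<in> carrier_vec k" "transpose_mat ?A *\<^sub>v u = 0\<^sub>v ?N"
    let ?c = "transpose_mat G *\<^sub>v u"
    have "?c \<in> C" using u(1) generator_matrix_image[OF G] unfolding k_def by blast
    moreover have "?c $ j = 0" if j: "j \<in> J" "j < N" for j
    proof -
      \<comment> \<open>\<open>?p\<close> is the position of column \<open>j\<close> in the
        submatrix: columns keep their order, so it is the number of members of \<open>J\<close>
        below \<open>j\<close>.\<close>
      let ?p = "card {a \<in> J. a < j}"
      have p: "?p < ?N"
        using j by (intro psubset_card_mono) auto
      have "(transpose_mat ?A *\<^sub>v u) $ ?p = (\<Sum>i<k. ?A $$ (i, ?p) * u $ i)"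
        by (rule mult_transpose_index[OF A u(1) p])
      also have "\<dots> = (\<Sum>i<k. G $$ (i, j) * u $ i)"
        using Gc p j by (intro sum.cong) (auto simp: submatrix_index pick_UNIV pick_card_in_set)
      also have "\<dots> = ?c $ j" using mult_transpose_index[OF Gc u(1) j(2)] by simp
      finally show ?thesis using u(2) p by simp
    qed
    ultimately have "?c = 0\<^sub>v N" by (rule inj)
    moreover have "transpose_mat G *\<^sub>v 0\<^sub>v k = 0\<^sub>v N" using Gc by auto
    ultimately show "u = 0\<^sub>v k"
      using inj_onD[OF generator_matrix_inj[OF lin G], of u "0\<^sub>v k"] u(1) by (simp add: k_def)
  qed
  then show ?thesis by (simp add: k_def)
qed

section \<open>Weights and minimum distance\<close>

lemma vsymbol_nonzero_iff: "vsymbol \<alpha> c i \<noteq> 0\<^sub>v \<alpha> \<longleftrightarrow> (\<exists>j<\<alpha>. c $ (i * \<alpha> + j) \<noteq> 0)"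
  unfolding vsymbol_def vec_eq_iff by auto

lemma hamming_weight_scalar: "hamming_weight N 1 c = card {i. i < N \<and> c $ i \<noteq> 0}"
  unfolding hamming_weight_def vsymbol_nonzero_iff by simp

lemma finite_weights: "finite {hamming_weight n \<alpha> c | c. P c}"
proof (rule finite_subset)
  show "{hamming_weight n \<alpha> c | c. P c} \<subseteq> {..n}"
    unfolding hamming_weight_def by (auto intro: order_trans[OF card_mono[of "{..<n}"]])
qed simp

lemma min_dist_le:
  assumes "c \<in> C" "c \<noteq> 0\<^sub>v (n * \<alpha>)"
  shows "min_dist n \<alpha> C \<le> hamming_weight n \<alpha> c"
  unfolding min_dist_def using assms by (intro Min_le finite_weights) blast

lemma min_dist_eqI:
  assumes "\<And>c. c \<in> C \<Longrightarrow> c \<noteq> 0\<^sub>v (n * \<alpha>) \<Longrightarrow> x \<le> hamming_weight n \<alpha> c"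
    and "c \<in> C" "c \<noteq> 0\<^sub>v (n * \<alpha>)" "hamming_weight n \<alpha> c \<le> x"
  shows "min_dist n \<alpha> C = x"
  unfolding min_dist_def
proof (rule Min_eqI[OF finite_weights])
  show "x \<in> {hamming_weight n \<alpha> c | c. c \<in> C \<and> c \<noteq> 0\<^sub>v (n * \<alpha>)}"
    using assms by (metis (mono_tags, lifting) mem_Collect_eq order_antisym)
qed (use assms(1) in blast)

text \<open>The common form of puncturing, restriction to a block and storage on nodes. The map
  \<open>\<sigma>\<close> may repeat a coordinate, as storage does with every edge.\<close>

definition reindex :: "nat \<Rightarrow> (nat \<Rightarrow> nat) \<Rightarrow> 'a vec \<Rightarrow> 'a vec" where
  "reindex N \<sigma> c = vec N (\<lambda>p. c $ \<sigma> p)"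

lemma dim_reindex [simp]: "dim_vec (reindex N \<sigma> c) = N"
  by (simp add: reindex_def)

lemma reindex_carrier [simp]: "reindex N \<sigma> c \<in> carrier_vec N"
  by (simp add: reindex_def)

lemma reindex_index [simp]: "p < N \<Longrightarrow> reindex N \<sigma> c $ p = c $ \<sigma> p"
  by (simp add: reindex_def)

lemma linear_code_reindex:
  fixes C :: "'a::field vec set"
  assumes lin: "linear_code N C" and \<sigma>: "\<sigma> ` {..<N'} \<subseteq> {..<N}"
  shows "linear_code N' (reindex N' \<sigma> ` C)"
  unfolding linear_code_iff
proof (intro conjI ballI allI)
  note D = linear_codeD[OF lin]
  have \<sigma>': "\<sigma> p < N" if "p < N'" for p using that \<sigma> by auto
  show "0\<^sub>v N' \<in> reindex N' \<sigma> ` C"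
    using \<sigma>' by (intro image_eqI[OF _ D(2)] eq_vecI) auto
  show "c + c' \<in> reindex N' \<sigma> ` C"
    if cc: "c \<in> reindex N' \<sigma> ` C" "c' \<in> reindex N' \<sigma> ` C" for c c'
  proof -
    obtain b b' where b: "b \<in> C" "c = reindex N' \<sigma> b" "b' \<in> C" "c' = reindex N' \<sigma> b'"
      using cc by blast
    then have "b \<in> carrier_vec N" "b' \<in> carrier_vec N" using D(1) by auto
    with b \<sigma>' have "c + c' = reindex N' \<sigma> (b + b')" by (intro eq_vecI) auto
    then show ?thesis using D(3)[OF b(1,3)] by blast
  qed
  show "a \<cdot>\<^sub>v c \<in> reindex N' \<sigma> ` C" if c: "c \<in> reindex N' \<sigma> ` C" for a c
  proof -
    obtain b where b: "b \<in> C" "c = reindex N' \<sigma> b" using c by blast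
    then have "b \<in> carrier_vec N" using D(1) by auto
    with b \<sigma>' have "a \<cdot>\<^sub>v c = reindex N' \<sigma> (a \<cdot>\<^sub>v b)" by (intro eq_vecI) auto
    then show ?thesis using D(4)[OF b(1)] by blast
  qed
qed auto

text \<open>By \<open>ker\<close> no nonzero word vanishes on all coordinates that are read, so
  \<open>reindex\<close> is injective on the code, and equal cardinality gives equal
  dimension.\<close>

lemma code_dim_reindex:
  fixes C :: "'q::{field,finite} vec set"
  assumes lin: "linear_code N C" and \<sigma>: "\<sigma> ` {..<N'} \<subseteq> {..<N}"
    and ker: "\<And>c. c \<in> C \<Longrightarrow> (\<And>p. p < N' \<Longrightarrow> c $ \<sigma> p = 0) \<Longrightarrow> c = 0\<^sub>v N"
  shows "code_dim N' (reindex N' \<sigma> ` C) = code_dim N C"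
proof (rule code_dim_eqI[OF linear_code_reindex[OF lin \<sigma>]])
  have "inj_on (reindex N' \<sigma>) C"
  proof (rule inj_onI)
    fix c c' assume c: "c \<in> C" "c' \<in> C" and eq: "reindex N' \<sigma> c = reindex N' \<sigma> c'"
    have car: "c \<in> carrier_vec N" "c' \<in> carrier_vec N" using c linear_codeD(1)[OF lin] by auto
    have "c - c' = 0\<^sub>v N"
    proof (rule ker[OF linear_code_diff[OF lin c]])
      fix p assume p: "p < N'"
      then have "\<sigma> p < N" using \<sigma> by auto
      moreover have "c $ \<sigma> p = c' $ \<sigma> p" using arg_cong[OF eq, of "\<lambda>v. v $ p"] p by simp
      ultimately show "(c - c') $ \<sigma> p = 0" using car by simp
    qed
    then show "c = c'" by (rule minus_vec_eq_0D[OF car])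
  qed
  then show "card (reindex N' \<sigma> ` C) = CARD('q) ^ code_dim N C"
    by (simp add: card_image card_code[OF lin])
qed

section \<open>MDS codes\<close>

lemma mds_code_weight:
  assumes "mds_code N K M" "c \<in> M" "c \<noteq> 0\<^sub>v N"
  shows "N - K + 1 \<le> card {i. i < N \<and> c $ i \<noteq> 0}"
  using min_dist_le[of c M N 1] assms unfolding mds_code_def hamming_weight_scalar by simp

text \<open>A word with \<open>K\<close> zeros has weight at most \<open>N - K\<close>, one below
  the minimum distance: any \<open>K\<close> coordinates of an MDS code determine the word.\<close>

lemma mds_code_vanishing:
  assumes "mds_code N K M" "c \<in> M" "J \<subseteq> {..<N}" "K \<le> card J" "\<And>j. j \<in> J \<Longrightarrow> c $ j = 0"
  shows "c = 0\<^sub>v N"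
proof (rule ccontr)
  assume "c \<noteq> 0\<^sub>v N"
  then have "N - K + 1 \<le> card {i. i < N \<and> c $ i \<noteq> 0}" by (rule mds_code_weight[OF assms(1,2)])
  also have "\<dots> \<le> card ({..<N} - J)" using assms(5) by (intro card_mono) auto
  also have "\<dots> = N - card J" using assms(3) by (simp add: card_Diff_subset finite_subset)
  finally show False using assms(4) by simp
qed

text \<open>Enlarge \<open>J\<close> to \<open>K - 1\<close> coordinates avoiding \<open>j0\<close>
  and take a nonzero word vanishing there; a further zero at \<open>j0\<close> would make
  \<open>K\<close> zeros and hence the zero word.\<close>

lemma mds_code_dual_word:
  fixes M :: "'q::{field,finite} vec set"
  assumes mds: "mds_code N K M" and K: "1 \<le> K" "K \<le> N"
    and j0: "j0 < N" and J: "J \<subseteq> {..<N} - {j0}" "card J < K"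
  obtains c where "c \<in> M" "c $ j0 \<noteq> 0" "\<And>j. j \<in> J \<Longrightarrow> c $ j = 0"
proof -
  have "card ({..<N} - {j0}) = N - 1" using j0 by simp
  then have "card J \<le> K - 1" "K - 1 \<le> card ({..<N} - {j0})" using J(2) K by linarith+
  then obtain J' where J': "J \<subseteq> J'" "J' \<subseteq> {..<N} - {j0}" "card J' = K - 1"
    using exists_subset_between[of J "K - 1" "{..<N} - {j0}"] J(1) by blast
  have fin: "finite J'" by (rule finite_subset[OF J'(2)]) simp
  obtain c where c: "c \<in> M" "c \<noteq> 0\<^sub>v N" "\<And>j. j \<in> J' \<Longrightarrow> j < N \<Longrightarrow> c $ j = 0"
    using exists_codeword_vanishing[of N M J'] mds fin J'(3) K unfolding mds_code_def by auto
  have "c $ j0 \<noteq> 0"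
  proof
    assume "c $ j0 = 0"
    moreover have "K \<le> card (insert j0 J')" using fin J'(2,3) K(1) by (subst card_insert_disjoint) auto
    ultimately have "c = 0\<^sub>v N"
      using J'(2) c(3) j0 by (intro mds_code_vanishing[OF mds c(1), of "insert j0 J'"]) auto
    then show False using c(2) by simp
  qed
  then show thesis using that[of c] c(1,3) J' by blast
qed

text \<open>The Singleton bound supplies the other half of the distance: in dimension
  \<open>K\<close> some nonzero word vanishes on the first \<open>K - 1\<close> coordinates.\<close>

lemma mds_codeI:
  fixes M :: "'q::{field,finite} vec set"
  assumes lin: "linear_code N M" and dim: "code_dim N M = K" and K: "1 \<le> K" "K \<le> N"
    and wt: "\<And>c. c \<in> M \<Longrightarrow> c \<noteq> 0\<^sub>v N \<Longrightarrow> N - K + 1 \<le> card {i. i < N \<and> c $ i \<noteq> 0}"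
  shows "mds_code N K M"
proof -
  obtain c where c: "c \<in> M" "c \<noteq> 0\<^sub>v N" "\<And>j. j \<in> {..<K - 1} \<Longrightarrow> j < N \<Longrightarrow> c $ j = 0"
    using exists_codeword_vanishing[OF lin, of "{..<K - 1}"] dim K by auto
  have "card {i. i < N \<and> c $ i \<noteq> 0} \<le> card {K - 1..<N}"
    using c(3) by (intro card_mono) (auto simp: not_less[symmetric])
  then have "hamming_weight N 1 c \<le> N - K + 1" unfolding hamming_weight_scalar using K by simp
  then have "min_dist N 1 M = N - K + 1"
    using c(1,2) wt[folded hamming_weight_scalar] by (intro min_dist_eqI[of M N 1 _ c]) simp_all
  then show ?thesis using lin dim by (simp add: mds_code_def)
qed

lemma code_dim_eq_by_information_set:
  fixes C :: "'q::{field,finite} vec set"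
  assumes lin: "linear_code N C" and \<sigma>: "\<sigma> ` {..<k} \<subseteq> {..<N}"
    and ker: "\<And>c. c \<in> C \<Longrightarrow> (\<And>p. p < k \<Longrightarrow> c $ \<sigma> p = 0) \<Longrightarrow> c = 0\<^sub>v N"
    and onto: "\<And>u. u \<in> carrier_vec k \<Longrightarrow> \<exists>c\<in>C. \<forall>p<k. c $ \<sigma> p = u $ p"
  shows "code_dim N C = k"
proof -
  have "reindex k \<sigma> ` C = carrier_vec k"
  proof
    show "carrier_vec k \<subseteq> reindex k \<sigma> ` C"
    proof
      fix u :: "'q vec" assume u: "u \<in> carrier_vec k"
      then obtain c where "c \<in> C" "\<forall>p<k. c $ \<sigma> p = u $ p" using onto by blast
      then show "u \<in> reindex k \<sigma> ` C" using u by (intro image_eqI[of _ _ c] eq_vecI) auto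
    qed
  qed auto
  then have "code_dim k (reindex k \<sigma> ` C) = k"
    by (intro code_dim_eqI[OF linear_code_reindex[OF lin \<sigma>]]) (simp add: card_carrier_vec)
  then show ?thesis using code_dim_reindex[OF lin \<sigma> ker] by simp
qed

section \<open>Words of a pyramid code\<close>

lemma dim_hcat [simp]: "dim_row (hcat A B) = dim_row A" "dim_col (hcat A B) = dim_col A + dim_col B"
  by (simp_all add: hcat_def)

lemma hcat_index:
  "i < dim_row A \<Longrightarrow> j < dim_col A + dim_col B \<Longrightarrow>
    hcat A B $$ (i, j) = (if j < dim_col A then A $$ (i, j) else B $$ (i, j - dim_col A))"
  by (simp add: hcat_def)

text \<open>Blocks of one common shape let block and offset be read off by \<open>div\<close> and
  \<open>mod\<close>. In the induction, prepending a block raises both quotients by one and leaves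
  both remainders alone.\<close>

lemma diag_block_mat_uniform:
  assumes "\<And>A. A \<in> set As \<Longrightarrow> A \<in> carrier_mat a b" "0 < a" "0 < b"
  shows "diag_block_mat As \<in> carrier_mat (length As * a) (length As * b)"
    and "x < length As * a \<Longrightarrow> y < length As * b \<Longrightarrow>
      diag_block_mat As $$ (x, y) =
        (if x div a = y div b then (As ! (x div a)) $$ (x mod a, y mod b) else 0)"
proof -
  have "diag_block_mat As \<in> carrier_mat (length As * a) (length As * b) \<and>
    (\<forall>x < length As * a. \<forall>y < length As * b. diag_block_mat As $$ (x, y) =
        (if x div a = y div b then (As ! (x div a)) $$ (x mod a, y mod b) else 0))"
    using assms(1)
  proof (induction As)
    case (Cons A As)
    let ?B = "diag_block_mat As"
    have A: "A \<in> carrier_mat a b" using Cons.prems by simp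
    have IH: "?B \<in> carrier_mat (length As * a) (length As * b)"
      "\<And>x y. x < length As * a \<Longrightarrow> y < length As * b \<Longrightarrow> ?B $$ (x, y) =
        (if x div a = y div b then (As ! (x div a)) $$ (x mod a, y mod b) else 0)"
      using Cons by simp_all
    have dim: "dim_row ?B = length As * a" "dim_col ?B = length As * b"
      "dim_row A = a" "dim_col A = b"
      using IH(1) A by auto
    have "diag_block_mat (A # As) $$ (x, y) =
        (if x div a = y div b then ((A # As) ! (x div a)) $$ (x mod a, y mod b) else 0)"
      if xy: "x < a + length As * a" "y < b + length As * b" for x y
    proof -
      have e: "diag_block_mat (A # As) $$ (x, y) =
        (if x < a then if y < b then A $$ (x, y) else 0
         else if y < b then 0 else ?B $$ (x - a, y - b))"
        using xy by (auto simp: Let_def dim)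
      show ?thesis
      proof (cases "x < a")
        case True
        then have x': "x div a = 0" "x mod a = x" by simp_all
        show ?thesis
        proof (cases "y < b")
          case T: True
          then have "y div b = 0" "y mod b = y" by simp_all
          then show ?thesis unfolding e using True T x' by simp
        next
          case False
          then have "y div b = Suc ((y - b) div b)" using assms(3) by (simp add: le_div_geq)
          then show ?thesis unfolding e using True False x' by simp
        qed
      next
        case False
        then have x': "x div a = Suc ((x - a) div a)" "x mod a = (x - a) mod a" "x - a < length As * a"
          using assms(2) xy by (auto simp: le_div_geq le_mod_geq)
        show ?thesis
        proof (cases "y < b")
          case True
          then show ?thesis unfolding e using False x' by simp
        next
          case F: False
          then have "y div b = Suc ((y - b) div b)" "y mod b = (y - b) mod b" "y - b < length As * b"
            using assms(3) xy by (auto simp: le_div_geq le_mod_geq)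
          then show ?thesis unfolding e using False F x' IH(2) by simp
        qed
      qed
    qed
    moreover have "diag_block_mat (A # As) \<in> carrier_mat (length (A # As) * a) (length (A # As) * b)"
      unfolding diag_block_mat.simps Let_def using dim by (intro carrier_matI) simp_all
    moreover have "length (A # As) * a = a + length As * a" "length (A # As) * b = b + length As * b"
      by simp_all
    ultimately show ?case by metis
  qed simp
  then show "diag_block_mat As \<in> carrier_mat (length As * a) (length As * b)"
    "x < length As * a \<Longrightarrow> y < length As * b \<Longrightarrow>
      diag_block_mat As $$ (x, y) =
        (if x div a = y div b then (As ! (x div a)) $$ (x mod a, y mod b) else 0)"
    by blast+
qed

lemma block_index_less:
  fixes i a m n :: nat
  assumes "i < m" "a < n"
  shows "i * n + a < m * n"
proof -
  have "Suc i * n \<le> m * n" using assms(1) by (intro mult_le_mono1) simp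
  then show ?thesis using assms(2) by simp
qed

lemma block_index_split:
  fixes y m n :: nat
  assumes "y < m * n"
  shows "y div n < m" "y mod n < n" "y = y div n * n + y mod n"
proof -
  have "0 < n" using assms by (cases n) auto
  then show "y div n < m" "y mod n < n" "y = y div n * n + y mod n"
    using assms by (simp_all add: less_mult_imp_div_less)
qed

lemma block_index_div_mod:
  fixes a n :: nat
  assumes "a < n"
  shows "(i * n + a) div n = i" "(i * n + a) mod n = a"
  using assms by (simp_all add: div_mult_self3)

lemma pyramid_matrix_entries:
  fixes Q Q' :: "'a::field mat"
  assumes Q: "Q \<in> carrier_mat (m * K) e" and Q': "Q' \<in> carrier_mat (m * K) t" and K: "0 < K"
  shows "pyramid_matrix m K Q Q' \<in> carrier_mat (m * K) (m * (K + e) + t)"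
    and "x < m * K \<Longrightarrow> i < m \<Longrightarrow> a < K + e \<Longrightarrow> pyramid_matrix m K Q Q' $$ (x, i * (K + e) + a) =
      (if x div K = i then if a < K then if x mod K = a then 1 else 0 else Q $$ (x, a - K) else 0)"
    and "x < m * K \<Longrightarrow> b < t \<Longrightarrow> pyramid_matrix m K Q Q' $$ (x, m * (K + e) + b) = Q' $$ (x, b)"
proof -
  let ?As = "map (\<lambda>i. hcat (1\<^sub>m K) (row_block K Q i)) [0..<m]"
  let ?B = "diag_block_mat ?As"
  have dims: "dim_row (hcat (1\<^sub>m K) (row_block K Q i)) = K"
    "dim_col (hcat (1\<^sub>m K) (row_block K Q i)) = K + e" for i
    using Q by (auto simp: row_block_def)
  have As: "A \<in> carrier_mat K (K + e)" if A: "A \<in> set ?As" for A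
    using A dims by (auto intro!: carrier_matI)
  note B = diag_block_mat_uniform[of ?As, OF _ K, of "K + e", OF As]
  have Bc: "?B \<in> carrier_mat (m * K) (m * (K + e))" using B(1) K by simp
  then have Bd: "dim_row ?B = m * K" "dim_col ?B = m * (K + e)" by auto
  have Qd: "dim_col Q' = t" "dim_col Q = e" using Q Q' by auto
  show "pyramid_matrix m K Q Q' \<in> carrier_mat (m * K) (m * (K + e) + t)"
    unfolding pyramid_matrix_def using Bd Qd by (intro carrier_matI) simp_all
  show "pyramid_matrix m K Q Q' $$ (x, m * (K + e) + b) = Q' $$ (x, b)" if "x < m * K" "b < t"
    unfolding pyramid_matrix_def using that Bd Qd by (subst hcat_index) simp_all
  show "pyramid_matrix m K Q Q' $$ (x, i * (K + e) + a) =
      (if x div K = i then if a < K then if x mod K = a then 1 else 0 else Q $$ (x, a - K) else 0)"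
    if x: "x < m * K" and i: "i < m" and a: "a < K + e"
  proof -
    have y: "i * (K + e) + a < m * (K + e)" by (rule block_index_less[OF i a])
    have d: "(i * (K + e) + a) div (K + e) = i" "(i * (K + e) + a) mod (K + e) = a" by (rule block_index_div_mod[OF a])+
    have xK: "x div K < m" "x mod K < K" using x K by (simp_all add: less_mult_imp_div_less)
    have "pyramid_matrix m K Q Q' $$ (x, i * (K + e) + a) = ?B $$ (x, i * (K + e) + a)"
      unfolding pyramid_matrix_def using x y Bd by (subst hcat_index) simp_all
    also have "\<dots> = (if x div K = i then (?As ! (x div K)) $$ (x mod K, a) else 0)"
      using B(2)[of x "i * (K + e) + a"] K x y d by simp
    also have "(?As ! (x div K)) $$ (x mod K, a) =
        (if a < K then if x mod K = a then 1 else 0 else Q $$ (x, a - K))"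
      using xK a Qd by (auto simp: hcat_index row_block_def)
    finally show ?thesis .
  qed
qed

text \<open>A local parity of block \<open>i\<close> is the share that the message symbols of this
  block contribute to the unsplit parity; this is why local parities of equal index add up to it.
  Here \<open>e\<close> is the number of parities that are split.\<close>

lemma pyramid_word:
  fixes Q Q' :: "'a::field mat"
  assumes Q: "Q \<in> carrier_mat (m * K) e" and Q': "Q' \<in> carrier_mat (m * K) t" and K: "0 < K"
    and u: "u \<in> carrier_vec (m * K)"
  defines "c \<equiv> transpose_mat (pyramid_matrix m K Q Q') *\<^sub>v u"
  shows "i < m \<Longrightarrow> a < K \<Longrightarrow> c $ (i * (K + e) + a) = u $ (i * K + a)"
    and "i < m \<Longrightarrow> b < e \<Longrightarrow> c $ (i * (K + e) + (K + b)) =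
      (\<Sum>x<m * K. if x div K = i then Q $$ (x, b) * u $ x else 0)"
    and "b < t \<Longrightarrow> c $ (m * (K + e) + b) = (\<Sum>x<m * K. Q' $$ (x, b) * u $ x)"
proof -
  note P = pyramid_matrix_entries[OF Q Q' K]
  have idx: "c $ y = (\<Sum>x<m * K. pyramid_matrix m K Q Q' $$ (x, y) * u $ x)"
    if "y < m * (K + e) + t" for y
    unfolding c_def using that by (rule mult_transpose_index[OF P(1) u])
  have loc: "i * (K + e) + a < m * (K + e) + t" if "i < m" "a < K + e" for i a
    using block_index_less[OF that] by simp
  show "c $ (i * (K + e) + a) = u $ (i * K + a)" if i: "i < m" and a: "a < K"
  proof -
    have x0: "i * K + a < m * K" by (rule block_index_less[OF i a])
    have "c $ (i * (K + e) + a) =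
        (\<Sum>x<m * K. pyramid_matrix m K Q Q' $$ (x, i * (K + e) + a) * u $ x)"
      using a by (intro idx loc i) simp
    also have "\<dots> = (\<Sum>x<m * K. if x = i * K + a then u $ x else 0)"
    proof (intro sum.cong refl)
      fix x assume x: "x \<in> {..<m * K}"
      have "x div K = i \<and> x mod K = a \<longleftrightarrow> x = i * K + a"
        using a div_mult_mod_eq[of x K] by auto
      then show "pyramid_matrix m K Q Q' $$ (x, i * (K + e) + a) * u $ x =
          (if x = i * K + a then u $ x else 0)"
        using P(2)[of x i a] x i a by auto
    qed
    also have "\<dots> = u $ (i * K + a)" using x0 by simp
    finally show ?thesis .
  qed
  show "c $ (i * (K + e) + (K + b)) =
      (\<Sum>x<m * K. if x div K = i then Q $$ (x, b) * u $ x else 0)" if i: "i < m" and b: "b < e"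
  proof -
    have "c $ (i * (K + e) + (K + b)) =
        (\<Sum>x<m * K. pyramid_matrix m K Q Q' $$ (x, i * (K + e) + (K + b)) * u $ x)"
      using b by (intro idx loc i) simp
    also have "\<dots> = (\<Sum>x<m * K. if x div K = i then Q $$ (x, b) * u $ x else 0)"
      using P(2)[of _ i "K + b"] i b by (intro sum.cong refl) simp
    finally show ?thesis .
  qed
  show "c $ (m * (K + e) + b) = (\<Sum>x<m * K. Q' $$ (x, b) * u $ x)" if b: "b < t"
    using b P(3)[OF _ b] by (subst idx) (auto intro!: sum.cong)
qed

lemma systematic_word:
  fixes Q Q' :: "'a::field mat"
  assumes Q: "Q \<in> carrier_mat k e" and Q': "Q' \<in> carrier_mat k t"
    and u: "u \<in> carrier_vec k"
  defines "w \<equiv> transpose_mat (hcat (hcat (1\<^sub>m k) Q) Q') *\<^sub>v u"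
  shows "x < k \<Longrightarrow> w $ x = u $ x"
    and "b < e \<Longrightarrow> w $ (k + b) = (\<Sum>x<k. Q $$ (x, b) * u $ x)"
    and "b < t \<Longrightarrow> w $ (k + e + b) = (\<Sum>x<k. Q' $$ (x, b) * u $ x)"
proof -
  have dims: "dim_col Q = e" "dim_col Q' = t" using Q Q' by auto
  have H: "hcat (hcat (1\<^sub>m k) Q) Q' \<in> carrier_mat k (k + e + t)"
    using dims by (intro carrier_matI) simp_all
  have idx: "w $ y = (\<Sum>x<k. hcat (hcat (1\<^sub>m k) Q) Q' $$ (x, y) * u $ x)" if "y < k + e + t" for y
    unfolding w_def using that by (rule mult_transpose_index[OF H u])
  show "w $ x = u $ x" if x: "x < k"
  proof -
    have "w $ x = (\<Sum>x'<k. hcat (hcat (1\<^sub>m k) Q) Q' $$ (x', x) * u $ x')"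
      using x by (intro idx) simp
    also have "\<dots> = (\<Sum>x'<k. if x' = x then u $ x' else 0)"
      using x dims by (intro sum.cong refl) (simp add: hcat_index)
    finally show ?thesis using x by simp
  qed
  show "w $ (k + b) = (\<Sum>x<k. Q $$ (x, b) * u $ x)" if "b < e"
    using that dims by (subst idx) (auto simp: hcat_index intro!: sum.cong)
  show "w $ (k + e + b) = (\<Sum>x<k. Q' $$ (x, b) * u $ x)" if "b < t"
    using that dims by (subst idx) (auto simp: hcat_index intro!: sum.cong)
qed

text \<open>Relates a pyramid word \<open>c\<close> to the word \<open>w\<close> of the unsplit
  systematic code with the same message: each of the \<open>e\<close> split parities is restored as
  the sum of its local pieces. Stating this on words lets later proofs avoid messages and
  matrices.\<close>

definition pyramid_parent :: "nat \<Rightarrow> nat \<Rightarrow> nat \<Rightarrow> nat \<Rightarrow> 'a::field vec \<Rightarrow> 'a vec \<Rightarrow> bool" where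
  "pyramid_parent m K e t c w \<longleftrightarrow>
     (\<forall>i<m. \<forall>a<K. w $ (i * K + a) = c $ (i * (K + e) + a)) \<and>
     (\<forall>b<e. w $ (m * K + b) = (\<Sum>i<m. c $ (i * (K + e) + (K + b)))) \<and>
     (\<forall>b<t. w $ (m * K + e + b) = c $ (m * (K + e) + b))"

text \<open>With distance parameter \<open>e + 1\<close>, each block has \<open>e\<close> local
  parities and length \<open>K + e\<close>, free of truncated subtraction.\<close>

locale pyramid =
  fixes m K e t :: nat and A :: "'q::{field,finite} vec set"
  assumes K: "0 < K" and pyramid_code: "pyramid_code m K (e + 1) t A"
begin

abbreviation L where "L \<equiv> K + e"
abbreviation N where "N \<equiv> m * L + t"

text \<open>Collects all that later proofs use about the pyramid matrix: \<open>E\<close> is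
  systematic, block \<open>i\<close> of \<open>E u\<close> depends only on block \<open>i\<close> of
  \<open>u\<close>, and its words correspond to those of the parent MDS code \<open>W\<close> in
  both directions.\<close>

lemma encoder:
  obtains E W where "A = E ` carrier_vec (m * K)" "linear_code N A"
    "mds_code (m * K + e + t) (m * K) W"
    "\<And>u i a. u \<in> carrier_vec (m * K) \<Longrightarrow> i < m \<Longrightarrow> a < K \<Longrightarrow> E u $ (i * L + a) = u $ (i * K + a)"
    "\<And>u v i a. u \<in> carrier_vec (m * K) \<Longrightarrow> v \<in> carrier_vec (m * K) \<Longrightarrow> i < m \<Longrightarrow>
       (\<And>a. a < K \<Longrightarrow> u $ (i * K + a) = v $ (i * K + a)) \<Longrightarrow> a < L \<Longrightarrow> E u $ (i * L + a) = E v $ (i * L + a)"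
    "E (0\<^sub>v (m * K)) = 0\<^sub>v N"
    "\<And>u. u \<in> carrier_vec (m * K) \<Longrightarrow> \<exists>w\<in>W. pyramid_parent m K e t (E u) w"
    "\<And>w. w \<in> W \<Longrightarrow> \<exists>u\<in>carrier_vec (m * K). pyramid_parent m K e t (E u) w"
proof -
  obtain Q Q' where Q: "Q \<in> carrier_mat (m * K) e" "Q' \<in> carrier_mat (m * K) t"
    and mds: "mds_code (m * K + e + t) (m * K)
      (vec_space.row_space (m * K + e + t) (hcat (hcat (1\<^sub>m (m * K)) Q) Q'))"
    and A: "A = vec_space.row_space N (pyramid_matrix m K Q Q')"
    using pyramid_code unfolding pyramid_code_def by (auto simp: algebra_simps)
  let ?P = "pyramid_matrix m K Q Q'" and ?H = "hcat (hcat (1\<^sub>m (m * K)) Q) Q'"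
  define E where "E u = transpose_mat ?P *\<^sub>v u" for u
  define F where "F u = transpose_mat ?H *\<^sub>v u" for u
  let ?W = "vec_space.row_space (m * K + e + t) ?H"
  have Pc: "?P \<in> carrier_mat (m * K) N" by (rule pyramid_matrix_entries(1)[OF Q K])
  have dims: "dim_col Q = e" "dim_col Q' = t" using Q by auto
  have Hc: "?H \<in> carrier_mat (m * K) (m * K + e + t)"
    using dims by (intro carrier_matI) simp_all
  note pw = pyramid_word[OF Q K, folded E_def]
  note sw = systematic_word[OF Q, folded F_def]
  have W: "?W = F ` carrier_vec (m * K)" unfolding F_def by (rule row_space_carrier[OF Hc])
  have par: "pyramid_parent m K e t (E u) (F u)" if u: "u \<in> carrier_vec (m * K)" for u
    unfolding pyramid_parent_def
  proof (intro conjI allI impI)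
    fix i a assume "i < m" "a < K"
    then show "F u $ (i * K + a) = E u $ (i * L + a)"
      using pw(1)[OF u] sw(1)[OF u] block_index_less by simp
  next
    fix b assume b: "b < e"
    have "(\<Sum>i<m. E u $ (i * L + (K + b))) =
        (\<Sum>i<m. \<Sum>x<m * K. if x div K = i then Q $$ (x, b) * u $ x else 0)"
      using pw(2)[OF u _ b] by (intro sum.cong) auto
    also have "\<dots> = (\<Sum>x<m * K. \<Sum>i<m. if x div K = i then Q $$ (x, b) * u $ x else 0)"
      by (rule sum.swap)
    \<comment> \<open>Position \<open>x\<close> lies in one block only, \<open>x div K\<close>, so
      at most one term of the inner sum is nonzero.\<close>
    also have "\<dots> = (\<Sum>x<m * K. Q $$ (x, b) * u $ x)"
      using K by (intro sum.cong refl) (simp add: less_mult_imp_div_less)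
    also have "\<dots> = F u $ (m * K + b)" using sw(2)[OF u b] by simp
    finally show "F u $ (m * K + b) = (\<Sum>i<m. E u $ (i * L + (K + b)))" ..
  next
    fix b assume "b < t"
    then show "F u $ (m * K + e + b) = E u $ (m * L + b)" using pw(3)[OF u] sw(3)[OF u] by simp
  qed
  show thesis
  proof (rule that[of E ?W])
    show "A = E ` carrier_vec (m * K)" unfolding A E_def by (rule row_space_carrier[OF Pc])
    show "linear_code N A" unfolding A by (rule linear_code_row_space[OF Pc])
    show "mds_code (m * K + e + t) (m * K) ?W" by (rule mds)
    show "E u $ (i * L + a) = u $ (i * K + a)"
      if "u \<in> carrier_vec (m * K)" "i < m" "a < K" for u i a by (rule pw(1)[OF that])
    show "E u $ (i * L + a) = E v $ (i * L + a)"
      if u: "u \<in> carrier_vec (m * K)" and v: "v \<in> carrier_vec (m * K)" and i: "i < m"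
        and uv: "\<And>a. a < K \<Longrightarrow> u $ (i * K + a) = v $ (i * K + a)" and a: "a < L" for u v i a
    proof (cases "a < K")
      case True
      then show ?thesis using pw(1)[OF u i] pw(1)[OF v i] uv by simp
    next
      case False
      then have b: "a - K < e" "a = K + (a - K)" using a by simp_all
      have "u $ x = v $ x" if "x div K = i" for x
        using uv[of "x mod K"] K div_mult_mod_eq[of x K] that by auto
      then have "(\<Sum>x<m * K. if x div K = i then Q $$ (x, a - K) * u $ x else 0) =
          (\<Sum>x<m * K. if x div K = i then Q $$ (x, a - K) * v $ x else 0)"
        by (intro sum.cong refl) simp
      then show ?thesis using pw(2)[OF u i b(1)] pw(2)[OF v i b(1)] b(2) by simp
    qed
    show "E (0\<^sub>v (m * K)) = 0\<^sub>v N" unfolding E_def using Pc by (intro eq_vecI) auto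
    show "\<exists>w\<in>?W. pyramid_parent m K e t (E u) w" if "u \<in> carrier_vec (m * K)" for u
      using par[OF that] W that by blast
    show "\<exists>u\<in>carrier_vec (m * K). pyramid_parent m K e t (E u) w" if "w \<in> ?W" for w
      using par that unfolding W by blast
  qed
qed

lemma linear: "linear_code N A"
  by (rule encoder)

lemma systematic_onto:
  assumes "u \<in> carrier_vec (m * K)"
  obtains c where "c \<in> A" "\<And>i a. i < m \<Longrightarrow> a < K \<Longrightarrow> c $ (i * L + a) = u $ (i * K + a)"
proof -
  obtain E where "A = E ` carrier_vec (m * K)"
    "\<And>u i a. u \<in> carrier_vec (m * K) \<Longrightarrow> i < m \<Longrightarrow> a < K \<Longrightarrow> E u $ (i * L + a) = u $ (i * K + a)"
    by (rule encoder) blast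
  then show thesis using that[of "E u"] assms by blast
qed

lemma systematic_zero:
  assumes "c \<in> A" and zero: "\<And>i a. i < m \<Longrightarrow> a < K \<Longrightarrow> c $ (i * L + a) = 0"
  shows "c = 0\<^sub>v N"
proof -
  obtain E where E: "A = E ` carrier_vec (m * K)"
    "\<And>u i a. u \<in> carrier_vec (m * K) \<Longrightarrow> i < m \<Longrightarrow> a < K \<Longrightarrow> E u $ (i * L + a) = u $ (i * K + a)"
    "E (0\<^sub>v (m * K)) = 0\<^sub>v N"
    by (rule encoder) blast
  obtain u where u: "u \<in> carrier_vec (m * K)" "c = E u" using assms(1) E(1) by blast
  have "u = 0\<^sub>v (m * K)"
  proof (rule eq_vecI)
    fix x assume "x < dim_vec (0\<^sub>v (m * K) :: 'q vec)"
    then have x: "x < m * K" by simp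
    then have "x div K < m" "x mod K < K" using K by (simp_all add: less_mult_imp_div_less)
    then have "u $ (x div K * K + x mod K) = 0" using zero E(2)[OF u(1)] u(2) by metis
    then show "u $ x = 0\<^sub>v (m * K) $ x" using x by simp
  qed (use u in simp)
  then show ?thesis using u(2) E(3) by simp
qed

text \<open>Encode the message anew with all blocks but the \<open>i\<close>-th set to zero. Local
  symbols depend only on their own block; the global parities change in an uncontrolled way, so
  nothing is claimed about them.\<close>

lemma isolate_block:
  assumes "c \<in> A" and i: "i < m"
  obtains c' where "c' \<in> A" "\<And>a. a < L \<Longrightarrow> c' $ (i * L + a) = c $ (i * L + a)"
    "\<And>j a. j < m \<Longrightarrow> j \<noteq> i \<Longrightarrow> a < L \<Longrightarrow> c' $ (j * L + a) = 0"
proof (rule encoder)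
  fix E :: "'q vec \<Rightarrow> 'q vec" and W
  assume E: "A = E ` carrier_vec (m * K)"
    "\<And>u v i a. u \<in> carrier_vec (m * K) \<Longrightarrow> v \<in> carrier_vec (m * K) \<Longrightarrow> i < m \<Longrightarrow>
       (\<And>a. a < K \<Longrightarrow> u $ (i * K + a) = v $ (i * K + a)) \<Longrightarrow> a < L \<Longrightarrow> E u $ (i * L + a) = E v $ (i * L + a)"
    "E (0\<^sub>v (m * K)) = 0\<^sub>v N"
  obtain u where u: "u \<in> carrier_vec (m * K)" "c = E u" using assms(1) E(1) by blast
  define v where "v = vec (m * K) (\<lambda>x. if x div K = i then u $ x else 0)"
  have v: "v \<in> carrier_vec (m * K)" by (simp add: v_def)
  have vi: "v $ (j * K + a) = (if j = i then u $ (j * K + a) else 0)" if "j < m" "a < K" for j a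
    using block_index_less[OF that] block_index_div_mod[OF that(2)] by (simp add: v_def)
  show thesis
  proof (rule that[of "E v"])
    show "E v \<in> A" using E(1) v by blast
    show "E v $ (i * L + a) = c $ (i * L + a)" if "a < L" for a
      unfolding u(2) by (rule E(2)[OF v u(1) i _ that]) (simp add: vi i)
    show "E v $ (j * L + a) = 0" if j: "j < m" "j \<noteq> i" and a: "a < L" for j a
    proof -
      have "E v $ (j * L + a) = E (0\<^sub>v (m * K)) $ (j * L + a)"
        by (rule E(2)[OF v _ j(1) _ a]) (use j block_index_less in \<open>simp_all add: vi\<close>)
      then show ?thesis using E(3) block_index_less[OF j(1) a] by simp
    qed
  qed
qed

lemma parent_code:
  "\<exists>W. mds_code (m * K + e + t) (m * K) W \<and>
    (\<forall>c\<in>A. \<exists>w\<in>W. pyramid_parent m K e t c w) \<and> (\<forall>w\<in>W. \<exists>c\<in>A. pyramid_parent m K e t c w)"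
proof (rule encoder)
  fix E W
  assume "A = E ` carrier_vec (m * K)" "mds_code (m * K + e + t) (m * K) W"
    "\<And>u. u \<in> carrier_vec (m * K) \<Longrightarrow> \<exists>w\<in>W. pyramid_parent m K e t (E u) w"
    "\<And>w. w \<in> W \<Longrightarrow> \<exists>u\<in>carrier_vec (m * K). pyramid_parent m K e t (E u) w"
  then show ?thesis by blast
qed

end

section \<open>Minimum weight of a pyramid code and its local MDS codes\<close>

context pyramid
begin

text \<open>Each symbol of a word of the parent MDS code is a symbol of the pyramid word or, in the case
  of a local parity, a sum of such symbols; so the support of the former embeds into that of the latter.\<close>

lemma weight:
  assumes c: "c \<in> A" "c \<noteq> 0\<^sub>v N"
  shows "e + 1 + t \<le> card {y. y < N \<and> c $ y \<noteq> 0}"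
proof -
  obtain W where W: "mds_code (m * K + e + t) (m * K) W"
    "\<forall>c\<in>A. \<exists>w\<in>W. pyramid_parent m K e t c w"
    "\<forall>w\<in>W. \<exists>c\<in>A. pyramid_parent m K e t c w"
    using parent_code by blast
  obtain w where w: "w \<in> W" "pyramid_parent m K e t c w" using W(2) c(1) by blast
  let ?M = "m * K + e + t"
  have parent_sys: "w $ (i * K + a) = c $ (i * L + a)" if "i < m" "a < K" for i a
    using w(2) that by (simp add: pyramid_parent_def)
  have "w \<noteq> 0\<^sub>v ?M"
  proof
    assume z: "w = 0\<^sub>v ?M"
    have "c = 0\<^sub>v N"
    proof (rule systematic_zero[OF c(1)])
      fix i a assume ia: "i < m" "a < K"
      then have "w $ (i * K + a) = 0" using z block_index_less[OF ia] by simp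
      then show "c $ (i * L + a) = 0" using parent_sys[OF ia] by simp
    qed
    then show False using c(2) by simp
  qed
  then have "?M - m * K + 1 \<le> card {x. x < ?M \<and> w $ x \<noteq> 0}" by (rule mds_code_weight[OF W(1) w(1)])
  also have "\<dots> \<le> card {y. y < N \<and> c $ y \<noteq> 0}"
  proof -
    \<comment> \<open>\<open>g\<close> sends pyramid coordinates to parent coordinates and folds the
      \<open>m\<close> local parities of equal index onto one. It is not injective in general, but
      the image of the support of \<open>c\<close> covers that of \<open>w\<close>, which is what
      the count needs.\<close>
    define g where "g y = (if y < m * L then
        if y mod L < K then y div L * K + y mod L else m * K + (y mod L - K)
        else m * K + e + (y - m * L))" for y
    have "{x. x < ?M \<and> w $ x \<noteq> 0} \<subseteq> g ` {y. y < N \<and> c $ y \<noteq> 0}"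
    proof
      fix x assume "x \<in> {x. x < ?M \<and> w $ x \<noteq> 0}"
      then have x: "x < ?M" "w $ x \<noteq> 0" by simp_all
      consider (sys) "x < m * K" | (loc) "m * K \<le> x" "x < m * K + e" | (glob) "m * K + e \<le> x"
        by linarith
      then show "x \<in> g ` {y. y < N \<and> c $ y \<noteq> 0}"
      proof cases
        case sys
        define i a where "i = x div K" and "a = x mod K"
        have ia: "i < m" "a < K" "x = i * K + a"
          unfolding i_def a_def by (rule block_index_split[OF sys])+
        then have a: "a < L" by simp
        have "c $ (i * L + a) \<noteq> 0" using parent_sys[OF ia(1,2)] x(2) ia(3) by simp
        moreover have "g (i * L + a) = x"
          using block_index_less[OF ia(1) a] block_index_div_mod[OF a] ia(2,3) by (simp add: g_def)
        moreover have "i * L + a < N" using block_index_less[OF ia(1) a] by simp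
        ultimately show ?thesis by (intro image_eqI[of _ _ "i * L + a"]) auto
      next
        case loc
        define b where "b = x - m * K"
        have b: "b < e" "x = m * K + b" using loc by (simp_all add: b_def)
        have "(\<Sum>i<m. c $ (i * L + (K + b))) \<noteq> 0"
          using w(2) b x(2) unfolding pyramid_parent_def by metis
        then obtain i where i: "i < m" "c $ (i * L + (K + b)) \<noteq> 0"
          by (meson lessThan_iff sum.neutral)
        have a: "K + b < L" using b by simp
        have "g (i * L + (K + b)) = x"
          using block_index_less[OF i(1) a] block_index_div_mod[OF a, of i] b(2) by (simp add: g_def)
        moreover have "i * L + (K + b) < N" using block_index_less[OF i(1) a] by simp
        ultimately show ?thesis using i(2) by (intro image_eqI[of _ _ "i * L + (K + b)"]) auto
      next
        case glob
        define b where "b = x - (m * K + e)"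
        have b: "b < t" "x = m * K + e + b" using glob x(1) by (simp_all add: b_def)
        then have "c $ (m * L + b) \<noteq> 0" using w(2) x(2) by (simp add: pyramid_parent_def)
        moreover have "g (m * L + b) = x" using b(2) by (simp add: g_def)
        ultimately show ?thesis using b(1) by (intro image_eqI[of _ _ "m * L + b"]) auto
      qed
    qed
    then have "card {x. x < ?M \<and> w $ x \<noteq> 0} \<le> card (g ` {y. y < N \<and> c $ y \<noteq> 0})"
      by (intro card_mono) auto
    also have "\<dots> \<le> card {y. y < N \<and> c $ y \<noteq> 0}" by (intro card_image_le) simp
    finally show ?thesis .
  qed
  finally show ?thesis by simp
qed

text \<open>Punctured from \<open>A\<close> and not built from the block of \<open>Q\<close>: in
  this form the local codes reappear as restrictions of the stored code.\<close>

definition local_code :: "nat \<Rightarrow> 'q vec set" where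
  "local_code i = reindex L (\<lambda>a. i * L + a) ` A"

lemma block_less: "i < m \<Longrightarrow> a < L \<Longrightarrow> i * L + a < N"
  using block_index_less[of i m a L] by simp

lemma linear_local_code: "i < m \<Longrightarrow> linear_code L (local_code i)"
  unfolding local_code_def using block_less by (intro linear_code_reindex[OF linear]) auto

lemma local_code_extend:
  assumes "v \<in> local_code i" and i: "i < m"
  obtains c where "c \<in> A" "\<And>a. a < L \<Longrightarrow> c $ (i * L + a) = v $ a"
    "\<And>j a. j < m \<Longrightarrow> j \<noteq> i \<Longrightarrow> a < L \<Longrightarrow> c $ (j * L + a) = 0"
proof -
  obtain c0 where c0: "c0 \<in> A" "v = reindex L (\<lambda>a. i * L + a) c0"
    using assms(1) unfolding local_code_def by blast
  obtain c where "c \<in> A" "\<And>a. a < L \<Longrightarrow> c $ (i * L + a) = c0 $ (i * L + a)"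
    "\<And>j a. j < m \<Longrightarrow> j \<noteq> i \<Longrightarrow> a < L \<Longrightarrow> c $ (j * L + a) = 0"
    using isolate_block[OF c0(1) i] by blast
  then show thesis using that c0(2) by simp
qed

text \<open>Extended by zero to the other blocks, \<open>v\<close> becomes part of a pyramid word of
  weight at least \<open>e + 1 + t\<close>. At most \<open>t\<close> of this weight sits on global
  parities, so the rest lies in block \<open>i\<close>.\<close>

lemma local_weight:
  assumes v: "v \<in> local_code i" "v \<noteq> 0\<^sub>v L" and i: "i < m"
  shows "e + 1 \<le> card {a. a < L \<and> v $ a \<noteq> 0}"
proof -
  obtain c where c: "c \<in> A" "\<And>a. a < L \<Longrightarrow> c $ (i * L + a) = v $ a"
    "\<And>j a. j < m \<Longrightarrow> j \<noteq> i \<Longrightarrow> a < L \<Longrightarrow> c $ (j * L + a) = 0"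
    using local_code_extend[OF v(1) i] by blast
  have vL: "dim_vec v = L" using linear_codeD(1)[OF linear_local_code[OF i]] v(1) by auto
  have "c \<noteq> 0\<^sub>v N"
  proof
    assume "c = 0\<^sub>v N"
    then have "v = 0\<^sub>v L" using c(2) block_less[OF i] vL by (intro eq_vecI) auto
    then show False using v(2) by simp
  qed
  then have "e + 1 + t \<le> card {y. y < N \<and> c $ y \<noteq> 0}" by (rule weight[OF c(1)])
  also have "\<dots> \<le> card ((\<lambda>a. i * L + a) ` {a. a < L \<and> v $ a \<noteq> 0} \<union> {m * L..<N})"
  proof (intro card_mono subsetI)
    fix y assume "y \<in> {y. y < N \<and> c $ y \<noteq> 0}"
    then have y: "y < N" "c $ y \<noteq> 0" by simp_all
    show "y \<in> (\<lambda>a. i * L + a) ` {a. a < L \<and> v $ a \<noteq> 0} \<union> {m * L..<N}"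
    proof (cases "y < m * L")
      case True
      define j a where "j = y div L" and "a = y mod L"
      have ja: "j < m" "a < L" "y = j * L + a"
        unfolding j_def a_def by (rule block_index_split[OF True])+
      then have "j = i" using c(3)[OF ja(1) _ ja(2)] y(2) by auto
      then have "v $ a \<noteq> 0" using c(2)[OF ja(2)] y(2) ja(3) by simp
      then show ?thesis using ja \<open>j = i\<close> by blast
    qed (use y in simp)
  qed simp
  also have "\<dots> \<le> card {a. a < L \<and> v $ a \<noteq> 0} + t"
    by (rule order_trans[OF card_Un_le]) (simp add: card_image_le)
  finally show ?thesis by simp
qed

text \<open>The first \<open>K\<close> coordinates are an information set: a nonzero word vanishing
  there would have weight at most \<open>e\<close>, and every message occurs because the encoder is
  systematic.\<close>

lemma code_dim_local_code:
  assumes i: "i < m"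
  shows "code_dim L (local_code i) = K"
proof (rule code_dim_eq_by_information_set[OF linear_local_code[OF i], of id])
  fix v assume v: "v \<in> local_code i" "\<And>p. p < K \<Longrightarrow> v $ id p = 0"
  show "v = 0\<^sub>v L"
  proof (rule ccontr)
    assume "v \<noteq> 0\<^sub>v L"
    then have "e + 1 \<le> card {a. a < L \<and> v $ a \<noteq> 0}" by (rule local_weight[OF v(1) _ i])
    also have "\<dots> \<le> card {K..<L}" using v(2) by (intro card_mono) (auto simp: not_less[symmetric])
    finally show False by simp
  qed
next
  fix u :: "'q vec" assume u: "u \<in> carrier_vec K"
  \<comment> \<open>The message is simply repeated in every block, since only block \<open>i\<close>
    is read.\<close>
  define u' where "u' = vec (m * K) (\<lambda>x. u $ (x mod K))"
  have "u' \<in> carrier_vec (m * K)" by (simp add: u'_def)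
  then obtain c where c: "c \<in> A" "\<And>i a. i < m \<Longrightarrow> a < K \<Longrightarrow> c $ (i * L + a) = u' $ (i * K + a)"
    using systematic_onto by blast
  have "u' $ (i * K + a) = u $ a" if "a < K" for a
    using block_index_less[OF i that] that by (simp add: u'_def)
  then have "\<forall>p<K. reindex L (\<lambda>a. i * L + a) c $ id p = u $ p" by (simp add: c(2)[OF i])
  then show "\<exists>v\<in>local_code i. \<forall>p<K. v $ id p = u $ p" unfolding local_code_def using c(1) by blast
qed auto

lemma mds_local_code: "i < m \<Longrightarrow> mds_code L K (local_code i)"
  using local_weight K
  by (intro mds_codeI linear_local_code code_dim_local_code) auto

lemma code_dim: "code_dim N A = m * K"
proof (rule code_dim_eq_by_information_set[OF linear, of "\<lambda>x. x div K * L + x mod K"])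
  note * = block_index_split[of _ m K]
  then show "(\<lambda>x. x div K * L + x mod K) ` {..<m * K} \<subseteq> {..<N}"
    using block_less by fastforce
  fix u :: "'q vec" assume "u \<in> carrier_vec (m * K)"
  then obtain c where "c \<in> A" "\<And>i a. i < m \<Longrightarrow> a < K \<Longrightarrow> c $ (i * L + a) = u $ (i * K + a)"
    using systematic_onto by blast
  then show "\<exists>c\<in>A. \<forall>p<m * K. c $ (p div K * L + p mod K) = u $ p"
    using * by (intro bexI[of _ c]) auto
next
  fix c assume c: "c \<in> A" "\<And>p. p < m * K \<Longrightarrow> c $ (p div K * L + p mod K) = 0"
  show "c = 0\<^sub>v N"
  proof (rule systematic_zero[OF c(1)])
    fix i a assume "i < m" "a < K"
    then show "c $ (i * L + a) = 0"
      using c(2)[OF block_index_less] block_index_div_mod[of a K i] by metis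
  qed
qed

text \<open>In the parent MDS code the global parities are ordinary coordinates, so its dual words
  apply, and \<open>pyramid_parent\<close> copies these coordinates unchanged. Needed for the thick
  columns of global nodes.\<close>

lemma global_dual_word:
  assumes b0: "b0 < t" and B: "B \<subseteq> {..<t} - {b0}" "card B < m * K"
  obtains c where "c \<in> A" "c $ (m * L + b0) \<noteq> 0" "\<And>b. b \<in> B \<Longrightarrow> c $ (m * L + b) = 0"
proof -
  obtain W where W: "mds_code (m * K + e + t) (m * K) W"
    "\<forall>c\<in>A. \<exists>w\<in>W. pyramid_parent m K e t c w"
    "\<forall>w\<in>W. \<exists>c\<in>A. pyramid_parent m K e t c w"
    using parent_code by blast
  let ?J = "(\<lambda>b. m * K + e + b) ` B"
  have "card ?J < m * K" using B(2) by (simp add: card_image)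
  moreover have "?J \<subseteq> {..<m * K + e + t} - {m * K + e + b0}" using B(1) by auto
  moreover have "1 \<le> m * K" "m * K \<le> m * K + e + t" "m * K + e + b0 < m * K + e + t" using b0 B(2) by linarith+
  ultimately obtain w where w: "w \<in> W" "w $ (m * K + e + b0) \<noteq> 0" "\<And>j. j \<in> ?J \<Longrightarrow> w $ j = 0"
    using mds_code_dual_word[OF W(1), of "m * K + e + b0" ?J] by blast
  obtain c where c: "c \<in> A" "pyramid_parent m K e t c w" using W(3) w(1) by blast
  have "c $ (m * L + b) = w $ (m * K + e + b)" if "b < t" for b
    using c(2) that by (simp add: pyramid_parent_def)
  then show thesis using that[OF c(1)] w(2) w(3)[OF imageI] b0 B(1) by (metis Diff_iff lessThan_iff subsetD)
qed

end

section \<open>Edges of a complete graph\<close>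

lemma choose_two_Suc: "Suc n choose 2 = (n choose 2) + n"
  by (simp add: numeral_2_eq_2)

text \<open>A pair from a disjoint union lies inside one part, inside the other, or across.\<close>

lemma choose_two_add: "(a + b) choose 2 = (a choose 2) + (b choose 2) + a * b"
  by (induction b) (simp_all add: choose_two_Suc)

lemma choose_two_mono: "a \<le> b \<Longrightarrow> a choose 2 \<le> b choose 2"
  using choose_two_add[of a "b - a"] by simp

lemma sum_diff_lessThan:
  fixes d r :: nat
  shows "r \<le> Suc d \<Longrightarrow> (\<Sum>i<r. d - i) + (r choose 2) = r * d"
  by (induction r) (simp_all add: choose_two_Suc)

text \<open>In the complete graph on \<open>r + q\<close> vertices,
  \<open>K = (r choose 2) + r * q\<close> counts the edges meeting \<open>r\<close> fixed vertices;
  the others join the remaining \<open>q\<close>. The conclusions give the number of local parities,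
  the room for one node's symbols within an information set, and the MBR dimension formula.\<close>

lemma mbr_dimension_arith:
  fixes r q :: nat
  assumes "1 \<le> r" "1 \<le> q" and K: "K = r * (r + q - 1) - (r choose 2)"
  shows "K + (q choose 2) = (r + q) choose 2" and "r + q - 1 \<le> K"
    and "K = (\<Sum>i<r. r + q - 1 - i)"
proof -
  obtain r' where r': "r = Suc r'" using assms(1) by (cases r) auto
  obtain q' where q': "q = Suc q'" using assms(2) by (cases q) auto
  \<comment> \<open>The degrees of \<open>r\<close> vertices sum to \<open>r * (r + q - 1)\<close>,
    counting each inner edge twice; this makes the subtraction in \<open>K\<close> exact.\<close>
  have "2 * (r choose 2) = r * r'" unfolding r' by (simp add: choose_two)
  then have "r * (r + q - 1) = 2 * (r choose 2) + r * q"
    unfolding r' by (simp add: algebra_simps)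
  then have K': "K = (r choose 2) + r * q" using K by simp
  then show "K + (q choose 2) = (r + q) choose 2" by (simp add: choose_two_add)
  show "r + q - 1 \<le> K" unfolding K' by (simp add: r' q')
  show "K = (\<Sum>i<r. r + q - 1 - i)" using sum_diff_lessThan[of r "r + q - 1"] assms by linarith
qed

lemma sum_choose_two_le:
  fixes m :: nat
  shows "(\<Sum>i<m. l i choose 2) \<le> (\<Sum>i<m. l i) choose 2"
  by (induction m) (simp_all add: choose_two_add)

text \<open>Nodes beyond the first \<open>q\<close> are priced at \<open>n - 1\<close> edges each,
  which is what a global node stores; so local and global nodes become exchangeable in the distance
  bound. Induction on the excess \<open>x\<close>: removing one node from a group of size
  \<open>Suc k\<close> loses \<open>k \<le> n - 1\<close> edges.\<close>

lemma sum_choose_two_le_excess: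
  fixes l :: "nat \<Rightarrow> nat" and m n q x :: nat
  assumes "\<And>i. i < m \<Longrightarrow> l i \<le> n" "(\<Sum>i<m. l i) \<le> q + x"
  shows "(\<Sum>i<m. l i choose 2) \<le> (q choose 2) + x * (n - 1)"
  using assms
proof (induction x arbitrary: l)
  case 0
  then have "(\<Sum>i<m. l i) choose 2 \<le> q choose 2" by (intro choose_two_mono) simp
  then show ?case using sum_choose_two_le[of l m] by simp
next
  case (Suc x)
  show ?case
  proof (cases "\<exists>i<m. 0 < l i")
    case False
    then have "(\<Sum>i<m. l i choose 2) = 0" by (intro sum.neutral) (auto simp: binomial_eq_0)
    then show ?thesis by (metis zero_le)
  next
    case True
    then obtain i where i: "i < m" "0 < l i" by blast
    then obtain k where k: "l i = Suc k" by (cases "l i") auto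
    let ?l = "l(i := k)"
    have split: "(\<Sum>j<m. f j) = f i + (\<Sum>j\<in>{..<m} - {i}. f j)" for f :: "nat \<Rightarrow> nat"
      using i by (simp add: sum.remove)
    have rest: "(\<Sum>j\<in>{..<m} - {i}. f (?l j)) = (\<Sum>j\<in>{..<m} - {i}. f (l j))" for f :: "nat \<Rightarrow> nat"
      by (intro sum.cong) auto
    have "(\<Sum>j<m. ?l j) \<le> q + x"
      using Suc.prems(2) split[of l] split[of ?l] rest[of "\<lambda>y. y"] k by simp
    moreover have "?l j \<le> n" if "j < m" for j
      using Suc.prems(1)[OF that] k by auto
    ultimately have IH: "(\<Sum>j<m. ?l j choose 2) \<le> (q choose 2) + x * (n - 1)" by (rule Suc.IH[rotated])
    have "(\<Sum>j<m. l j choose 2) = (\<Sum>j<m. ?l j choose 2) + k"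
      using split[of "\<lambda>j. l j choose 2"] split[of "\<lambda>j. ?l j choose 2"] rest[of "\<lambda>y. y choose 2"] k
      by (simp add: choose_two_Suc)
    moreover have "k \<le> n - 1" using Suc.prems(1)[OF i(1)] k by simp
    ultimately show ?thesis using IH by simp
  qed
qed

section \<open>Symbols placed on edges and the nodes they make nonzero\<close>

locale edge_store =
  fixes n :: nat and place :: "nat \<Rightarrow> nat set" and slot :: "nat \<Rightarrow> nat \<Rightarrow> nat"
  assumes placement: "edge_placement n place slot"
begin

lemma bij_place: "bij_betw place {..<n choose 2} (complete_graph_edges n)"
  using placement by (simp add: edge_placement_def)

lemma bij_slot: "v < n \<Longrightarrow> bij_betw (slot v) {..<n - 1} {s. s < n choose 2 \<and> v \<in> place s}"
  using placement by (simp add: edge_placement_def)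

lemma place_edge: "s < n choose 2 \<Longrightarrow> place s \<subseteq> {..<n} \<and> card (place s) = 2"
  using bij_betwE[OF bij_place] by (auto simp: complete_graph_edges_def)

lemma slot_less: "v < n \<Longrightarrow> j < n - 1 \<Longrightarrow> slot v j < n choose 2"
  using bij_betwE[OF bij_slot] by auto

lemma in_place_slot: "v < n \<Longrightarrow> j < n - 1 \<Longrightarrow> v \<in> place (slot v j)"
  using bij_betwE[OF bij_slot] by auto

lemma slot_inj: "v < n \<Longrightarrow> j < n - 1 \<Longrightarrow> j' < n - 1 \<Longrightarrow> slot v j = slot v j' \<Longrightarrow> j = j'"
  using bij_betw_imp_inj_on[OF bij_slot] by (auto dest: inj_onD)

lemma slot_exists:
  assumes "v < n" "s < n choose 2" "v \<in> place s"
  obtains j where "j < n - 1" "slot v j = s"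
proof -
  have "s \<in> slot v ` {..<n - 1}" using bij_betw_imp_surj_on[OF bij_slot[OF assms(1)]] assms by auto
  then show thesis using that by auto
qed

lemma place_nonempty:
  assumes "s < n choose 2"
  obtains v where "v < n" "v \<in> place s"
proof -
  have "place s \<noteq> {}" using place_edge[OF assms] by auto
  then show thesis using that place_edge[OF assms] by auto
qed

lemma card_edges_within:
  assumes Z: "Z \<subseteq> {..<n}"
  shows "card {s. s < n choose 2 \<and> place s \<subseteq> Z} = card Z choose 2"
proof -
  have "bij_betw place {s. s < n choose 2 \<and> place s \<subseteq> Z} {e. e \<subseteq> Z \<and> card e = 2}"
    unfolding bij_betw_def
  proof
    show "inj_on place {s. s < n choose 2 \<and> place s \<subseteq> Z}"
      using bij_betw_imp_inj_on[OF bij_place] by (rule inj_on_subset) auto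
    show "place ` {s. s < n choose 2 \<and> place s \<subseteq> Z} = {e. e \<subseteq> Z \<and> card e = 2}"
    proof (intro equalityI subsetI)
      fix e assume e: "e \<in> {e. e \<subseteq> Z \<and> card e = 2}"
      then have "e \<in> place ` {..<n choose 2}"
        unfolding bij_betw_imp_surj_on[OF bij_place] using Z by (auto simp: complete_graph_edges_def)
      then show "e \<in> place ` {s. s < n choose 2 \<and> place s \<subseteq> Z}" using e by auto
    qed (use place_edge in auto)
  qed
  then have "card {s. s < n choose 2 \<and> place s \<subseteq> Z} = card {e. e \<subseteq> Z \<and> card e = 2}"
    by (rule bij_betw_same_card)
  also have "\<dots> = card Z choose 2" using Z finite_subset by (intro n_subsets) blast
  finally show ?thesis .
qed

text \<open>Complementary count: an edge misses \<open>T\<close> exactly if it lies within the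
  remaining nodes.\<close>

lemma card_edges_touching:
  assumes T: "T \<subseteq> {..<n}"
  shows "card {s. s < n choose 2 \<and> place s \<inter> T \<noteq> {}} = (n choose 2) - (n - card T choose 2)"
proof -
  have fin: "finite T" using T finite_subset by blast
  have "{s. s < n choose 2 \<and> place s \<inter> T \<noteq> {}} =
      {..<n choose 2} - {s. s < n choose 2 \<and> place s \<subseteq> {..<n} - T}"
    using place_edge by blast
  then have "card {s. s < n choose 2 \<and> place s \<inter> T \<noteq> {}} =
      card {..<n choose 2} - card {s. s < n choose 2 \<and> place s \<subseteq> {..<n} - T}"
    by (simp add: card_Diff_subset subset_iff)
  also have "card {s. s < n choose 2 \<and> place s \<subseteq> {..<n} - T} = card ({..<n} - T) choose 2"
    by (rule card_edges_within) auto
  also have "card ({..<n} - T) = n - card T" using T fin by (simp add: card_Diff_subset)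
  finally show ?thesis by simp
qed

text \<open>For a word these are its nonzero nodes, described through edges and not through the
  arbitrary slot order. The argument is a function, so that it can also be one block of a longer
  word.\<close>

definition active_nodes :: "(nat \<Rightarrow> 'a::zero) \<Rightarrow> nat set" where
  "active_nodes f = {v. v < n \<and> (\<exists>s. s < n choose 2 \<and> v \<in> place s \<and> f s \<noteq> 0)}"

lemma active_nodes_subset: "active_nodes f \<subseteq> {..<n}"
  by (auto simp: active_nodes_def)

lemma active_iff:
  assumes v: "v < n"
  shows "v \<in> active_nodes f \<longleftrightarrow> (\<exists>j<n - 1. f (slot v j) \<noteq> 0)"
proof
  assume "v \<in> active_nodes f"
  then obtain s where s: "s < n choose 2" "v \<in> place s" "f s \<noteq> 0" by (auto simp: active_nodes_def)
  obtain j where "j < n - 1" "slot v j = s" using slot_exists[OF v s(1,2)] .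
  then show "\<exists>j<n - 1. f (slot v j) \<noteq> 0" using s(3) by blast
next
  assume "\<exists>j<n - 1. f (slot v j) \<noteq> 0"
  then show "v \<in> active_nodes f"
    unfolding active_nodes_def using v slot_less[OF v] in_place_slot[OF v] by blast
qed

lemma support_within_active:
  "s < n choose 2 \<Longrightarrow> f s \<noteq> 0 \<Longrightarrow> place s \<subseteq> active_nodes f"
  using place_edge[of s] by (auto simp: active_nodes_def)

lemma card_support_le: "card {s. s < n choose 2 \<and> f s \<noteq> 0} \<le> card (active_nodes f) choose 2"
proof -
  have "card {s. s < n choose 2 \<and> f s \<noteq> 0} \<le> card {s. s < n choose 2 \<and> place s \<subseteq> active_nodes f}"
    using support_within_active by (intro card_mono) auto
  then show ?thesis by (simp add: card_edges_within[OF active_nodes_subset])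
qed

end

section \<open>Repair by transfer\<close>

lemma store_on_nodes_eq_reindex:
  "store_on_nodes n slot = reindex (n * (n - 1)) (\<lambda>p. slot (p div (n - 1)) (p mod (n - 1)))"
  by (intro ext) (simp add: store_on_nodes_def reindex_def)

text \<open>\<open>q\<close> stands for \<delta> - 1: any \<open>r\<close> nodes recover the word,
  and the other \<open>q\<close> nodes share \<open>q choose 2\<close> edges.\<close>

locale transfer_code = edge_store +
  fixes r q K :: nat and M :: "'q::{field,finite} vec set"
  assumes r: "1 \<le> r" and q: "1 \<le> q" and n: "n = r + q"
    and K: "K = r * (n - 1) - (r choose 2)"
    and mds: "mds_code (n choose 2) K M"
begin

abbreviation stored :: "'q vec set" where "stored \<equiv> store_on_nodes n slot ` M"

lemma arith: "K + (q choose 2) = n choose 2" "n - 1 \<le> K" "K = (\<Sum>i<r. n - 1 - i)"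
  using mbr_dimension_arith[OF r q K[unfolded n]] unfolding n by blast+

lemma K_bounds: "1 \<le> K" "K \<le> n choose 2"
  using arith(1,2) n r q by linarith+

lemma linear_M: "linear_code (n choose 2) M"
  using mds by (simp add: mds_code_def)

lemma carrier_M: "b \<in> M \<Longrightarrow> b \<in> carrier_vec (n choose 2)"
  using linear_codeD(1)[OF linear_M] by blast

lemma slots_subset:
  "(\<lambda>p. slot (p div (n - 1)) (p mod (n - 1))) ` {..<n * (n - 1)} \<subseteq> {..<n choose 2}"
  using slot_less block_index_split[of _ n "n - 1"] by auto

lemma store_index:
  "v < n \<Longrightarrow> j < n - 1 \<Longrightarrow> store_on_nodes n slot b $ (v * (n - 1) + j) = b $ slot v j"
  unfolding store_on_nodes_eq_reindex
  using block_index_less[of v n j "n - 1"] block_index_div_mod[of j "n - 1" v] by simp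

lemma linear_stored: "linear_code (n * (n - 1)) stored"
  unfolding store_on_nodes_eq_reindex by (rule linear_code_reindex[OF linear_M slots_subset])

text \<open>Every edge has an end node, so each symbol of \<open>M\<close> is stored somewhere and
  no nonzero word is lost; storing it twice does not change the dimension.\<close>

lemma code_dim_stored: "code_dim (n * (n - 1)) stored = K"
proof -
  have "code_dim (n * (n - 1)) stored = code_dim (n choose 2) M"
    unfolding store_on_nodes_eq_reindex
  proof (rule code_dim_reindex[OF linear_M slots_subset])
    fix b assume b: "b \<in> M"
      and zero: "\<And>p. p < n * (n - 1) \<Longrightarrow> b $ slot (p div (n - 1)) (p mod (n - 1)) = 0"
    show "b = 0\<^sub>v (n choose 2)"
    proof (rule eq_vecI)
      fix s assume "s < dim_vec (0\<^sub>v (n choose 2) :: 'q vec)"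
      then have s: "s < n choose 2" by simp
      obtain v where v: "v < n" "v \<in> place s" using place_nonempty[OF s] .
      obtain j where j: "j < n - 1" "slot v j = s" using slot_exists[OF v(1) s v(2)] .
      have "b $ s = 0"
        using zero[OF block_index_less[OF v(1) j(1)]] block_index_div_mod[OF j(1), of v] j(2) by simp
      then show "b $ s = 0\<^sub>v (n choose 2) $ s" using s by simp
    qed (use carrier_M[OF b] in simp)
  qed
  then show ?thesis using mds by (simp add: mds_code_def)
qed

text \<open>The other \<open>n - 2\<close> symbols of the node are fewer than \<open>K\<close>, so
  the MDS code has a word vanishing on them but not at slot \<open>j\<close>.\<close>

lemma node_dual_word:
  assumes v: "v < n" and j: "j < n - 1"
  obtains b where "b \<in> M" "b $ slot v j \<noteq> 0" "\<And>j'. j' < n - 1 \<Longrightarrow> j' \<noteq> j \<Longrightarrow> b $ slot v j' = 0"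
proof -
  let ?J = "slot v ` ({..<n - 1} - {j})"
  have "?J \<subseteq> {..<n choose 2} - {slot v j}" using slot_less[OF v] slot_inj[OF v _ j] by auto
  moreover have "card ?J < K"
  proof -
    have "card ?J \<le> card ({..<n - 1} - {j})" by (rule card_image_le) simp
    then show ?thesis using arith(2) j by simp
  qed
  ultimately obtain b where "b \<in> M" "b $ slot v j \<noteq> 0" "\<And>s. s \<in> ?J \<Longrightarrow> b $ s = 0"
    using mds_code_dual_word[OF mds K_bounds slot_less[OF v j], of ?J] by blast
  then show thesis using that[of b] by blast
qed

lemma vector_code_stored: "vector_code n (n - 1) stored"
proof (rule vector_codeI[OF linear_stored])
  fix v j assume v: "v < n" and j: "j < n - 1"
  obtain b where b: "b \<in> M" "b $ slot v j \<noteq> 0"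
    "\<And>j'. j' < n - 1 \<Longrightarrow> j' \<noteq> j \<Longrightarrow> b $ slot v j' = 0"
    using node_dual_word[OF v j] by blast
  show "\<exists>c\<in>stored. c $ (v * (n - 1) + j) \<noteq> 0 \<and>
      (\<forall>j'<n - 1. j' \<noteq> j \<longrightarrow> c $ (v * (n - 1) + j') = 0)"
    using b store_index[OF v, of _ b] j by (intro bexI[of _ "store_on_nodes n slot b"]) auto
qed

lemma vsymbol_store_eqD:
  assumes eq: "vsymbol (n - 1) (store_on_nodes n slot b) v = vsymbol (n - 1) (store_on_nodes n slot b') v"
    and v: "v < n" and j: "j < n - 1"
  shows "b $ slot v j = b' $ slot v j"
  using arg_cong[OF eq, of "\<lambda>x. x $ j"] j by (simp add: vsymbol_def store_index[OF v j] del: One_nat_def)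

lemma determined_by_nodes:
  assumes T: "T \<subseteq> {..<n}" "card T = r" and b: "b \<in> M" "b' \<in> M"
    and eq: "\<And>v. v \<in> T \<Longrightarrow> vsymbol (n - 1) (store_on_nodes n slot b) v =
      vsymbol (n - 1) (store_on_nodes n slot b') v"
  shows "b = b'"
proof (rule minus_vec_eq_0D[OF carrier_M[OF b(1)] carrier_M[OF b(2)]])
  let ?J = "{s. s < n choose 2 \<and> place s \<inter> T \<noteq> {}}"
  show "b - b' = 0\<^sub>v (n choose 2)"
  proof (rule mds_code_vanishing[OF mds linear_code_diff[OF linear_M b]])
    show "?J \<subseteq> {..<n choose 2}" by auto
    have "n - card T = q" using T(2) n by simp
    then show "K \<le> card ?J" unfolding card_edges_touching[OF T(1)] using arith(1) by simp
    fix s assume "s \<in> ?J"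
    then obtain v where v: "s < n choose 2" "v \<in> T" "v \<in> place s" by blast
    then have vn: "v < n" using T(1) by blast
    obtain j where j: "j < n - 1" "slot v j = s" using slot_exists[OF vn v(1,3)] .
    have "b $ s = b' $ s" using vsymbol_store_eqD[OF eq[OF v(2)] vn j(1)] j(2) by simp
    then show "(b - b') $ s = 0" using carrier_M[OF b(2)] v(1) by simp
  qed
qed

text \<open>Helper \<open>h\<close> transfers the one symbol it shares with \<open>i\<close>, on the
  edge \<open>{h, i}\<close>. These are all the edges at \<open>i\<close>, so the claim holds for
  arbitrary vectors \<open>b\<close> and \<open>b'\<close>: repair involves no decoding.\<close>

lemma repair_node:
  assumes i: "i < n"
  shows "\<exists>\<phi> :: nat \<Rightarrow> 'q mat. (\<forall>h. \<phi> h \<in> carrier_mat 1 (n - 1)) \<and>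
    (\<forall>b b'. (\<forall>h<n. h \<noteq> i \<longrightarrow> \<phi> h *\<^sub>v vsymbol (n - 1) (store_on_nodes n slot b) h =
        \<phi> h *\<^sub>v vsymbol (n - 1) (store_on_nodes n slot b') h) \<longrightarrow>
      vsymbol (n - 1) (store_on_nodes n slot b) i = vsymbol (n - 1) (store_on_nodes n slot b') i)"
proof -
  have "\<exists>j. j < n - 1 \<and> place (slot h j) = {h, i}" if h: "h < n" "h \<noteq> i" for h
  proof -
    have "{h, i} \<in> place ` {..<n choose 2}"
      unfolding bij_betw_imp_surj_on[OF bij_place] using h i by (simp add: complete_graph_edges_def)
    then obtain s where s: "s < n choose 2" "place s = {h, i}" by auto
    obtain j where "j < n - 1" "slot h j = s" using slot_exists[OF h(1) s(1)] s(2) by blast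
    then show ?thesis using s(2) by blast
  qed
  then obtain e where e: "\<And>h. h < n \<Longrightarrow> h \<noteq> i \<Longrightarrow> e h < n - 1 \<and> place (slot h (e h)) = {h, i}"
    by metis
  \<comment> \<open>A unit row that picks the slot of \<open>h\<close> holding the edge
    \<open>{h, i}\<close>.\<close>
  define \<phi> where "\<phi> h = mat 1 (n - 1) (\<lambda>(x, j). if j = e h then 1 else 0 :: 'q)" for h
  have send: "(\<phi> h *\<^sub>v vsymbol (n - 1) (store_on_nodes n slot b) h) $ 0 = b $ slot h (e h)"
    if h: "h < n" "h \<noteq> i" for h b
  proof -
    have eh: "e h < n - 1" using e[OF h] by blast
    have "(\<phi> h *\<^sub>v vsymbol (n - 1) (store_on_nodes n slot b) h) $ 0 =
        (\<Sum>j<n - 1. (if j = e h then 1 else 0) * b $ slot h j)"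
      by (auto simp: \<phi>_def vsymbol_def scalar_prod_def store_index[OF h(1)] atLeast0LessThan
          simp del: One_nat_def)
    also have "\<dots> = (\<Sum>j<n - 1. if j = e h then b $ slot h j else 0)"
      by (intro sum.cong) auto
    finally show ?thesis using eh by simp
  qed
  show ?thesis
  proof (intro exI[of _ \<phi>] conjI allI impI)
    show "\<phi> h \<in> carrier_mat 1 (n - 1)" for h by (simp add: \<phi>_def)
    fix b b' :: "'q vec"
    assume eq: "\<forall>h<n. h \<noteq> i \<longrightarrow> \<phi> h *\<^sub>v vsymbol (n - 1) (store_on_nodes n slot b) h =
        \<phi> h *\<^sub>v vsymbol (n - 1) (store_on_nodes n slot b') h"
    show "vsymbol (n - 1) (store_on_nodes n slot b) i = vsymbol (n - 1) (store_on_nodes n slot b') i"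
    proof (rule eq_vecI)
      fix j assume "j < dim_vec (vsymbol (n - 1) (store_on_nodes n slot b') i)"
      then have j: "j < n - 1" by (simp add: vsymbol_def)
      let ?s = "slot i j"
      have s: "?s < n choose 2" "i \<in> place ?s" using slot_less[OF i j] in_place_slot[OF i j] .
      have "card (place ?s - {i}) = 1" using place_edge[OF s(1)] s(2) by simp
      \<comment> \<open>\<open>h\<close> is the far end of the edge in slot \<open>j\<close> of node
        \<open>i\<close>; as \<open>place\<close> is injective, the symbol sent by \<open>h\<close>
        is this very one.\<close>
      then obtain h where h: "place ?s - {i} = {h}" by (auto simp: card_1_singleton_iff)
      then have ph: "place ?s = {h, i}" "h \<noteq> i" using s(2) by auto
      then have hn: "h < n" using place_edge[OF s(1)] by auto
      have eh: "e h < n - 1" "place (slot h (e h)) = {h, i}" using e[OF hn ph(2)] by auto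
      have "slot h (e h) = ?s"
        using bij_betw_imp_inj_on[OF bij_place] slot_less[OF hn eh(1)] s(1) eh(2) ph(1)
        by (auto dest: inj_onD)
      then have "b $ ?s = b' $ ?s" using send[OF hn ph(2), of b] send[OF hn ph(2), of b'] eq hn ph(2) by metis
      then show "vsymbol (n - 1) (store_on_nodes n slot b) i $ j = vsymbol (n - 1) (store_on_nodes n slot b') i $ j"
        using j by (simp add: vsymbol_def store_index[OF i j] del: One_nat_def)
    qed (simp add: vsymbol_def)
  qed
qed

lemma regenerating_code_stored: "regenerating_code n r (n - 1) (n - 1) 1 K stored"
  unfolding regenerating_code_def
proof (intro conjI allI impI ballI vector_code_stored code_dim_stored)
  show "r \<le> n - 1" using n q by simp
next
  fix T c c'
  assume T: "T \<subseteq> {..<n} \<and> card T = r" and c: "c \<in> stored" "c' \<in> stored"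
    and eq: "\<forall>h\<in>T. vsymbol (n - 1) c h = vsymbol (n - 1) c' h"
  obtain b where b: "b \<in> M" "c = store_on_nodes n slot b" using c(1) by blast
  obtain b' where b': "b' \<in> M" "c' = store_on_nodes n slot b'" using c(2) by blast
  have "b = b'"
    using determined_by_nodes[OF conjunct1[OF T] conjunct2[OF T] b(1) b'(1)] eq b(2) b'(2) by blast
  then show "c = c'" using b(2) b'(2) by simp
next
  fix i D assume i: "i < n" and D: "D \<subseteq> {..<n} - {i} \<and> card D = n - 1"
  \<comment> \<open>With \<open>d = n - 1\<close> the helper set is forced to consist of all other
    nodes.\<close>
  have "D = {..<n} - {i}" using D i by (intro card_subset_eq) auto
  then have D': "h \<in> D" if "h < n" "h \<noteq> i" for h using that by simp
  obtain \<phi> :: "nat \<Rightarrow> 'q mat" where \<phi>: "\<forall>h. \<phi> h \<in> carrier_mat 1 (n - 1)"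
    "\<forall>b b'. (\<forall>h<n. h \<noteq> i \<longrightarrow> \<phi> h *\<^sub>v vsymbol (n - 1) (store_on_nodes n slot b) h =
        \<phi> h *\<^sub>v vsymbol (n - 1) (store_on_nodes n slot b') h) \<longrightarrow>
      vsymbol (n - 1) (store_on_nodes n slot b) i = vsymbol (n - 1) (store_on_nodes n slot b') i"
    using repair_node[OF i] by (elim exE conjE)
  show "\<exists>\<phi> :: nat \<Rightarrow> 'q mat. (\<forall>h\<in>D. \<phi> h \<in> carrier_mat 1 (n - 1)) \<and>
      (\<forall>c\<in>stored. \<forall>c'\<in>stored.
        (\<forall>h\<in>D. \<phi> h *\<^sub>v vsymbol (n - 1) c h = \<phi> h *\<^sub>v vsymbol (n - 1) c' h) \<longrightarrow>
        vsymbol (n - 1) c i = vsymbol (n - 1) c' i)"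
  proof (intro exI[of _ \<phi>] conjI ballI impI \<phi>(1)[rule_format])
    fix c c' assume c: "c \<in> stored" "c' \<in> stored"
      and eq: "\<forall>h\<in>D. \<phi> h *\<^sub>v vsymbol (n - 1) c h = \<phi> h *\<^sub>v vsymbol (n - 1) c' h"
    obtain b where b: "c = store_on_nodes n slot b" using c(1) by blast
    obtain b' where b': "c' = store_on_nodes n slot b'" using c(2) by blast
    show "vsymbol (n - 1) c i = vsymbol (n - 1) c' i"
      unfolding b b' using eq D' by (intro \<phi>(2)[rule_format]) (simp add: b b')
  qed
qed simp

lemma mbr_code_stored: "mbr_code n r (n - 1) (n - 1) 1 K stored"
  unfolding mbr_code_def using regenerating_code_stored arith(3) by simp

lemma repair_by_transfer_stored: "repair_by_transfer n r (n - 1) (n - 1) 1 K stored"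
  unfolding repair_by_transfer_def using K mds placement by (auto simp: mult.commute)

lemma active_lower:
  assumes b: "b \<in> M" "b \<noteq> 0\<^sub>v (n choose 2)"
  shows "q + 1 \<le> card (active_nodes (\<lambda>s. b $ s))"
proof (rule ccontr)
  assume "\<not> ?thesis"
  then have "card (active_nodes (\<lambda>s. b $ s)) choose 2 \<le> q choose 2" by (intro choose_two_mono) simp
  moreover have "(n choose 2) - K + 1 \<le> card (active_nodes (\<lambda>s. b $ s)) choose 2"
    using mds_code_weight[OF mds b] card_support_le[of "\<lambda>s. b $ s"] by linarith
  ultimately show False using arith(1) by linarith
qed

lemma exists_light_word:
  obtains b where "b \<in> M" "b \<noteq> 0\<^sub>v (n choose 2)" "card (active_nodes (\<lambda>s. b $ s)) \<le> q + 1"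
proof -
  let ?J = "{s. s < n choose 2 \<and> place s \<inter> {..<r - 1} \<noteq> {}}"
  have T: "{..<r - 1} \<subseteq> {..<n}" using n by auto
  have "n - card {..<r - 1} = Suc q" using n r by simp
  \<comment> \<open>The edges missing \<open>r - 1\<close> nodes number
    \<open>Suc q choose 2 = (q choose 2) + q\<close>, so \<open>?J\<close> has \<open>K - q\<close>
    elements, fewer than the dimension.\<close>
  then have "card ?J = (n choose 2) - ((q choose 2) + q)"
    unfolding card_edges_touching[OF T] by (simp add: choose_two_Suc)
  then have "card ?J < code_dim (n choose 2) M"
    using arith(1) K_bounds q mds unfolding mds_code_def by linarith
  then obtain b where b: "b \<in> M" "b \<noteq> 0\<^sub>v (n choose 2)"
    "\<And>s. s \<in> ?J \<Longrightarrow> s < n choose 2 \<Longrightarrow> b $ s = 0"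
    using exists_codeword_vanishing[OF linear_M, of ?J] by auto
  have "active_nodes (\<lambda>s. b $ s) \<subseteq> {r - 1..<n}"
  proof
    fix v assume "v \<in> active_nodes (\<lambda>s. b $ s)"
    then obtain s where s: "v < n" "s < n choose 2" "v \<in> place s" "b $ s \<noteq> 0"
      by (auto simp: active_nodes_def)
    have "s \<notin> ?J" using b(3)[of s] s(2,4) by blast
    then show "v \<in> {r - 1..<n}" using s by auto
  qed
  then have "card (active_nodes (\<lambda>s. b $ s)) \<le> card {r - 1..<n}" by (intro card_mono) simp
  then show thesis using that b(1,2) n r by simp
qed

lemma hamming_weight_store: "hamming_weight n (n - 1) (store_on_nodes n slot b) = card (active_nodes (\<lambda>s. b $ s))"
proof -
  have "vsymbol (n - 1) (store_on_nodes n slot b) v \<noteq> 0\<^sub>v (n - 1) \<longleftrightarrow> v \<in> active_nodes (\<lambda>s. b $ s)"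
    if v: "v < n" for v
    unfolding vsymbol_nonzero_iff active_iff[OF v] using store_index[OF v] by metis
  then have "{i. i < n \<and> vsymbol (n - 1) (store_on_nodes n slot b) i \<noteq> 0\<^sub>v (n - 1)} = active_nodes (\<lambda>s. b $ s)"
    using active_nodes_subset[of "\<lambda>s. b $ s"] by auto
  then show ?thesis by (simp add: hamming_weight_def)
qed

lemma store_zero: "store_on_nodes n slot (0\<^sub>v (n choose 2)) = (0\<^sub>v (n * (n - 1)) :: 'q vec)"
  unfolding store_on_nodes_eq_reindex using slots_subset by (intro eq_vecI) auto

lemma min_dist_stored: "min_dist n (n - 1) stored = q + 1"
proof -
  obtain b where b: "b \<in> M" "b \<noteq> 0\<^sub>v (n choose 2)" "card (active_nodes (\<lambda>s. b $ s)) \<le> q + 1"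
    by (rule exists_light_word)
  show ?thesis
  proof (rule min_dist_eqI)
    fix c assume c: "c \<in> stored" "c \<noteq> 0\<^sub>v (n * (n - 1))"
    then obtain b where b: "b \<in> M" "c = store_on_nodes n slot b" by blast
    then have "b \<noteq> 0\<^sub>v (n choose 2)" using c(2) store_zero by auto
    then show "q + 1 \<le> hamming_weight n (n - 1) c"
      unfolding b(2) hamming_weight_store by (rule active_lower[OF b(1)])
  next
    show "store_on_nodes n slot b \<in> stored" using b(1) by blast
    show "hamming_weight n (n - 1) (store_on_nodes n slot b) \<le> q + 1"
      unfolding hamming_weight_store by (rule b(3))
    show "store_on_nodes n slot b \<noteq> 0\<^sub>v (n * (n - 1))"
    proof
      assume z: "store_on_nodes n slot b = 0\<^sub>v (n * (n - 1))"
      have "hamming_weight n (n - 1) (0\<^sub>v (n * (n - 1)) :: 'q vec) = 0"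
        unfolding hamming_weight_def vsymbol_nonzero_iff
        using block_index_less[of _ n _ "n - 1"] by auto
      then show False using active_lower[OF b(1,2)] hamming_weight_store[of b] z by simp
    qed
  qed
qed

end

section \<open>The stored pyramid code\<close>

lemma pick_interval:
  assumes "p < l"
  shows "pick {a..<a + l} p = a + p"
proof -
  have "{x \<in> {a..<a + l}. x < a + p} = {a..<a + p}" using assms by auto
  then show ?thesis using pick_card_in_set[of "a + p" "{a..<a + l}"] assms by simp
qed

lemma thick_coords_interval: "thick_coords \<alpha> {a..<a + l} = {a * \<alpha>..<a * \<alpha> + l * \<alpha>}"
proof (intro equalityI subsetI)
  fix x assume "x \<in> thick_coords \<alpha> {a..<a + l}"
  then obtain i where i: "a \<le> i" "Suc i \<le> a + l" "i * \<alpha> \<le> x" "x < Suc i * \<alpha>"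
    by (auto simp: thick_coords_def)
  have "a * \<alpha> \<le> i * \<alpha>" "Suc i * \<alpha> \<le> (a + l) * \<alpha>" using i(1,2) by (intro mult_le_mono1; simp)+
  then show "x \<in> {a * \<alpha>..<a * \<alpha> + l * \<alpha>}" using i(3,4) unfolding atLeastLessThan_iff add_mult_distrib by linarith
next
  fix x assume x: "x \<in> {a * \<alpha>..<a * \<alpha> + l * \<alpha>}"
  then have "x - a * \<alpha> < l * \<alpha>" by auto
  from block_index_split[OF this] x
  have "(x - a * \<alpha>) div \<alpha> < l" "(x - a * \<alpha>) mod \<alpha> < \<alpha>"
    "x = (a + (x - a * \<alpha>) div \<alpha>) * \<alpha> + (x - a * \<alpha>) mod \<alpha>"
    by (simp_all add: add_mult_distrib)
  then have "a + (x - a * \<alpha>) div \<alpha> \<in> {a..<a + l}"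
    "x \<in> {(a + (x - a * \<alpha>) div \<alpha>) * \<alpha>..<(a + (x - a * \<alpha>) div \<alpha>) * \<alpha> + \<alpha>}"
    by auto
  then show "x \<in> thick_coords \<alpha> {a..<a + l}" unfolding thick_coords_def by blast
qed

text \<open>The thick coordinates of consecutive nodes form one interval, on which
  \<open>pick\<close> just counts on from the start; so the restriction is a shift and falls under
  \<open>reindex\<close>.\<close>

lemma code_restrict_interval:
  assumes C: "C \<subseteq> carrier_vec (n * \<alpha>)" and l: "a + l \<le> n"
  shows "code_restrict \<alpha> C {a..<a + l} = reindex (l * \<alpha>) (\<lambda>p. a * \<alpha> + p) ` C"
  unfolding code_restrict_def thick_coords_interval
proof (intro image_cong refl)
  fix c assume "c \<in> C"
  then have c: "dim_vec c = n * \<alpha>" using C by auto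
  have "(a + l) * \<alpha> \<le> n * \<alpha>" using l by (rule mult_le_mono1)
  then have "{j. j < dim_vec c \<and> j \<in> {a * \<alpha>..<a * \<alpha> + l * \<alpha>}} = {a * \<alpha>..<a * \<alpha> + l * \<alpha>}"
    unfolding c by (auto simp: add_mult_distrib)
  then show "subvector c {a * \<alpha>..<a * \<alpha> + l * \<alpha>} = reindex (l * \<alpha>) (\<lambda>p. a * \<alpha> + p) c"
    by (intro eq_vecI) (simp_all add: subvector_def pick_interval)
qed

text \<open>\<open>t\<close> counts scalar global parities, \<open>\<Delta>\<close> global nodes.
  \<open>L_eq\<close> matches the \<open>K + e\<close> symbols of a block with the edges of its
  graph and thereby forces \<open>e\<close> to be \<open>q choose 2\<close>.\<close>

locale stored_pyramid = pyramid m K e t A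
  for m K e t and A :: "'q::{field,finite} vec set" +
  fixes n r q \<Delta> :: nat and place :: "nat \<Rightarrow> nat \<Rightarrow> nat set" and slot :: "nat \<Rightarrow> nat \<Rightarrow> nat \<Rightarrow> nat"
    and grp :: "nat \<times> nat \<Rightarrow> nat"
  assumes m: "1 \<le> m" and r: "1 \<le> r" and q: "1 \<le> q" and n: "n = r + q"
    and K_eq: "K = r * (n - 1) - (r choose 2)" and L_eq: "L = n choose 2"
    and t_eq: "t = \<Delta> * (n - 1)"
    and edge_placement: "i < m \<Longrightarrow> edge_placement n (place i) (slot i)"
    and grp: "bij_betw grp ({..<\<Delta>} \<times> {..<n - 1}) {..<t}"
begin

lemma transfer: "i < m \<Longrightarrow> transfer_code n (place i) (slot i) r q K (local_code i)"
  using edge_placement r q n K_eq mds_local_code L_eq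
  by (simp add: transfer_code_def transfer_code_axioms_def edge_store_def)

lemma edges: "i < m \<Longrightarrow> edge_store n (place i) (slot i)"
  using edge_placement by (simp add: edge_store_def)

lemma slot_less: "i < m \<Longrightarrow> v < n \<Longrightarrow> j < n - 1 \<Longrightarrow> slot i v j < L"
  using edge_store.slot_less[OF edges] L_eq by simp

lemma grp_less: "g < \<Delta> \<Longrightarrow> j < n - 1 \<Longrightarrow> grp (g, j) < t"
  using bij_betwE[OF grp] by auto

lemma e_eq: "e = q choose 2"
  using mbr_dimension_arith(1)[OF r q K_eq[unfolded n]] L_eq n by simp

lemma n_le_K: "n - 1 \<le> K"
  using mbr_dimension_arith(2)[OF r q K_eq[unfolded n]] n by simp

abbreviation len where "len \<equiv> m * n + \<Delta>"
abbreviation store where "store \<equiv> pyramid_store n m \<Delta> slot grp"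
abbreviation C where "C \<equiv> store ` A"

definition source :: "nat \<Rightarrow> nat" where
  "source p = (let v = p div (n - 1); j = p mod (n - 1) in
     if v < m * n then (v div n) * L + slot (v div n) (v mod n) j else m * L + grp (v - m * n, j))"

lemma store_eq_reindex: "store = reindex (len * (n - 1)) source"
  unfolding pyramid_store_def reindex_def source_def L_eq Let_def by (intro ext arg_cong2[of _ _ _ _ vec] refl) auto

lemma source_local:
  assumes "i < m" "v < n" "j < n - 1"
  shows "source ((i * n + v) * (n - 1) + j) = i * L + slot i v j"
  unfolding source_def Let_def block_index_div_mod[OF assms(3)] block_index_div_mod[OF assms(2)]
  using block_index_less[OF assms(1,2)] by simp

lemma source_global:
  assumes "j < n - 1"
  shows "source ((m * n + g) * (n - 1) + j) = m * L + grp (g, j)"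
  unfolding source_def Let_def block_index_div_mod[OF assms] by simp

lemma local_node_less: "i < m \<Longrightarrow> v < n \<Longrightarrow> i * n + v < len"
  using block_index_less[of i m v n] by simp

lemma store_local:
  assumes "i < m" "v < n" "j < n - 1"
  shows "store c $ ((i * n + v) * (n - 1) + j) = c $ (i * L + slot i v j)"
  unfolding store_eq_reindex
  using block_index_less[OF local_node_less[OF assms(1,2)] assms(3)] source_local[OF assms] by simp

lemma store_global:
  assumes "g < \<Delta>" "j < n - 1"
  shows "store c $ ((m * n + g) * (n - 1) + j) = c $ (m * L + grp (g, j))"
proof -
  have "m * n + g < len" using assms(1) by simp
  from block_index_less[OF this assms(2)] show ?thesis
    unfolding store_eq_reindex using source_global[OF assms(2)] by simp
qed

lemma node_cases:
  assumes "v < len"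
  obtains (local) i u where "i < m" "u < n" "v = i * n + u" | (global) g where "g < \<Delta>" "v = m * n + g"
proof (cases "v < m * n")
  case True
  from local[OF block_index_split[OF True]] show thesis .
next
  case False
  then show thesis using global[of "v - m * n"] assms by simp
qed

lemma source_less:
  assumes p: "p < len * (n - 1)"
  shows "source p < N"
proof -
  note s = block_index_split[OF p]
  from s(1) show ?thesis
  proof (cases rule: node_cases)
    case (local i u)
    have "source p = i * L + slot i u (p mod (n - 1))"
      using source_local[OF local(1,2) s(2)] s(3) local(3) by simp
    then show ?thesis using block_less[OF local(1) slot_less[OF local(1,2) s(2)]] by simp
  next
    case (global g)
    have "source p = m * L + grp (g, p mod (n - 1))"
      using source_global[OF s(2), of g] s(3) global(2) by simp
    then show ?thesis using grp_less[OF global(1) s(2)] by simp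
  qed
qed

lemma source_subset: "source ` {..<len * (n - 1)} \<subseteq> {..<N}"
  using source_less by auto

lemma linear_C: "linear_code (len * (n - 1)) C"
  unfolding store_eq_reindex by (rule linear_code_reindex[OF linear source_subset])

text \<open>Each systematic symbol lies on an edge of its local graph, hence in a local node. This
  serves the dimension, the rank condition, and the passage from nonzero pyramid words to nonzero
  stored words.\<close>

lemma zero_if_local_nodes_zero:
  assumes c: "c \<in> A"
    and zero: "\<And>i v j. i < m \<Longrightarrow> v < n \<Longrightarrow> j < n - 1 \<Longrightarrow> c $ (i * L + slot i v j) = 0"
  shows "c = 0\<^sub>v N"
proof (rule systematic_zero[OF c])
  fix i a assume i: "i < m" and a: "a < K"
  then have a': "a < n choose 2" using L_eq by linarith
  obtain v where v: "v < n" "v \<in> place i a" using edge_store.place_nonempty[OF edges[OF i] a'] .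
  obtain j where "j < n - 1" "slot i v j = a" using edge_store.slot_exists[OF edges[OF i] v(1) a' v(2)] .
  then show "c $ (i * L + a) = 0" using zero[OF i v(1)] by blast
qed

lemma code_dim_C: "code_dim (len * (n - 1)) C = m * K"
  unfolding code_dim[symmetric] store_eq_reindex
proof (rule code_dim_reindex[OF linear source_subset])
  fix c assume c: "c \<in> A" "\<And>p. p < len * (n - 1) \<Longrightarrow> c $ source p = 0"
  show "c = 0\<^sub>v N"
  proof (rule zero_if_local_nodes_zero[OF c(1)])
    fix i v j assume ivj: "i < m" "v < n" "j < n - 1"
    show "c $ (i * L + slot i v j) = 0"
      using c(2)[OF block_index_less[OF local_node_less[OF ivj(1,2)] ivj(3)]] source_local[OF ivj] by simp
  qed
qed

text \<open>The two kinds of node draw their dual words from different codes: a local node from its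
  local MDS code, a global node from the parent MDS code.\<close>

lemma vector_code_C: "vector_code len (n - 1) C"
proof (rule vector_codeI[OF linear_C])
  fix v j assume "v < len" and j: "j < n - 1"
  then show "\<exists>c\<in>C. c $ (v * (n - 1) + j) \<noteq> 0 \<and> (\<forall>j'<n - 1. j' \<noteq> j \<longrightarrow> c $ (v * (n - 1) + j') = 0)"
  proof (cases rule: node_cases)
    case (local i u)
    obtain b where b: "b \<in> local_code i" "b $ slot i u j \<noteq> 0"
      "\<And>j'. j' < n - 1 \<Longrightarrow> j' \<noteq> j \<Longrightarrow> b $ slot i u j' = 0"
      using transfer_code.node_dual_word[OF transfer[OF local(1)] local(2) j] by blast
    obtain c where c: "c \<in> A" "b = reindex L (\<lambda>a. i * L + a) c" using b(1) unfolding local_code_def by blast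
    have "store c $ (v * (n - 1) + j') = b $ slot i u j'" if "j' < n - 1" for j'
      unfolding local(3) store_local[OF local(1,2) that] c(2) using slot_less[OF local(1,2) that] by simp
    then show ?thesis using b(2,3) c(1) j by (intro bexI[of _ "store c"]) auto
  next
    case (global g)
    \<comment> \<open>The other parities of the group, distinct from \<open>grp (g, j)\<close> by
      injectivity of \<open>grp\<close> and fewer than
      \<open>n - 1 \<le> K \<le> m * K\<close>.\<close>
    let ?B = "(\<lambda>j'. grp (g, j')) ` ({..<n - 1} - {j})"
    have "grp (g, j') \<noteq> grp (g, j)" if "j' < n - 1" "j' \<noteq> j" for j'
      using inj_onD[OF bij_betw_imp_inj_on[OF grp], of "(g, j')" "(g, j)"] that j global(1) by auto
    then have B: "?B \<subseteq> {..<t} - {grp (g, j)}" using grp_less[OF global(1)] by auto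
    have "card ?B \<le> card ({..<n - 1} - {j})" by (rule card_image_le) simp
    also have "\<dots> < n - 1" using j by simp
    also have "\<dots> \<le> m * K" using n_le_K m by (metis mult_1 mult_le_mono)
    finally obtain c where c: "c \<in> A" "c $ (m * L + grp (g, j)) \<noteq> 0" "\<And>b. b \<in> ?B \<Longrightarrow> c $ (m * L + b) = 0"
      using global_dual_word[OF grp_less[OF global(1) j] B] by blast
    then show ?thesis using store_global[OF global(1), of _ c] j unfolding global(2)
      by (intro bexI[of _ "store c"]) auto
  qed
qed

text \<open>Storing and then keeping the nodes of block \<open>i\<close> amounts to keeping block
  \<open>i\<close> of \<open>A\<close> and then storing it. All facts about a single stored MDS code
  thereby apply to the restriction of \<open>C\<close>.\<close>

lemma code_restrict_local:
  assumes i: "i < m"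
  shows "code_restrict (n - 1) C {i * n..<i * n + n} = store_on_nodes n (slot i) ` local_code i"
proof -
  have "Suc i * n \<le> m * n" using i by (intro mult_le_mono1) simp
  then have "code_restrict (n - 1) C {i * n..<i * n + n} = reindex (n * (n - 1)) (\<lambda>p. i * n * (n - 1) + p) ` C"
    by (intro code_restrict_interval[OF linear_codeD(1)[OF linear_C]]) simp
  also have "\<dots> = (\<lambda>c. reindex (n * (n - 1)) (\<lambda>p. i * n * (n - 1) + p) (store c)) ` A"
    by (simp add: image_image)
  also have "\<dots> = (\<lambda>c. store_on_nodes n (slot i) (reindex L (\<lambda>a. i * L + a) c)) ` A"
  proof (intro image_cong refl eq_vecI)
    fix c p assume "c \<in> A" and "p < dim_vec (store_on_nodes n (slot i) (reindex L (\<lambda>a. i * L + a) c))"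
    then have p: "p < n * (n - 1)" by (simp add: store_on_nodes_def)
    define v j where "v = p div (n - 1)" and "j = p mod (n - 1)"
    have vj: "v < n" "j < n - 1" "p = v * (n - 1) + j"
      unfolding v_def j_def by (rule block_index_split[OF p])+
    have "reindex (n * (n - 1)) (\<lambda>p. i * n * (n - 1) + p) (store c) $ p = store c $ ((i * n + v) * (n - 1) + j)"
      using p by (simp add: vj(3) add_mult_distrib add.assoc)
    also have "\<dots> = c $ (i * L + slot i v j)" by (rule store_local[OF i vj(1,2)])
    also have "\<dots> = store_on_nodes n (slot i) (reindex L (\<lambda>a. i * L + a) c) $ p"
      using p slot_less[OF i vj(1,2)] by (simp add: store_on_nodes_def v_def j_def)
    finally show "reindex (n * (n - 1)) (\<lambda>p. i * n * (n - 1) + p) (store c) $ p =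
      store_on_nodes n (slot i) (reindex L (\<lambda>a. i * L + a) c) $ p" .
  qed (simp add: store_on_nodes_def)
  also have "\<dots> = store_on_nodes n (slot i) ` local_code i" unfolding local_code_def by (simp add: image_image)
  finally show ?thesis .
qed

text \<open>The local nodes hold all systematic symbols, so only the zero word vanishes on
  them.\<close>

lemma rank_local_nodes:
  assumes G: "generator_matrix (len * (n - 1)) C G"
  shows "mat_rank (mat_restrict (n - 1) G (\<Union>i<m. {i * n..<i * n + n})) = code_dim (len * (n - 1)) C"
  unfolding mat_restrict_def
proof (rule mat_rank_submatrix_eq_code_dim[OF linear_C G])
  fix c assume "c \<in> C" and zero: "\<And>p. p \<in> thick_coords (n - 1) (\<Union>i<m. {i * n..<i * n + n}) \<Longrightarrow>
    p < len * (n - 1) \<Longrightarrow> c $ p = 0"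
  then obtain b where b: "b \<in> A" "c = store b" by blast
  have "b = 0\<^sub>v N"
  proof (rule zero_if_local_nodes_zero[OF b(1)])
    fix i v j assume ivj: "i < m" "v < n" "j < n - 1"
    have "(i * n + v) * (n - 1) + j \<in> thick_coords (n - 1) (\<Union>i<m. {i * n..<i * n + n})"
      unfolding thick_coords_def
    proof (rule UN_I)
      show "i * n + v \<in> (\<Union>i<m. {i * n..<i * n + n})" using ivj(1,2) by (intro UN_I[of i]) auto
    qed (use ivj(3) in simp)
    then show "b $ (i * L + slot i v j) = 0"
      using zero block_index_less[OF local_node_less[OF ivj(1,2)] ivj(3)]
      unfolding b(2) by (simp only: store_local[OF ivj, symmetric])
  qed
  then show "c = 0\<^sub>v (len * (n - 1))"
    unfolding b(2) store_eq_reindex using source_less by (intro eq_vecI) auto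
qed

section \<open>Weight of stored words in terms of nonzero nodes\<close>

definition local_active :: "'q vec \<Rightarrow> nat \<Rightarrow> nat set" where
  "local_active c i = edge_store.active_nodes n (place i) (\<lambda>s. c $ (i * L + s))"

definition global_active :: "'q vec \<Rightarrow> nat set" where
  "global_active c = {g. g < \<Delta> \<and> (\<exists>j<n - 1. c $ (m * L + grp (g, j)) \<noteq> 0)}"

lemma node_nonzero_local:
  assumes "i < m" "v < n"
  shows "vsymbol (n - 1) (store c) (i * n + v) \<noteq> 0\<^sub>v (n - 1) \<longleftrightarrow> v \<in> local_active c i"
  unfolding vsymbol_nonzero_iff local_active_def edge_store.active_iff[OF edges[OF assms(1)] assms(2)]
  using store_local[OF assms, of _ c] by metis

lemma node_nonzero_global:
  assumes "g < \<Delta>"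
  shows "vsymbol (n - 1) (store c) (m * n + g) \<noteq> 0\<^sub>v (n - 1) \<longleftrightarrow> g \<in> global_active c"
  unfolding vsymbol_nonzero_iff global_active_def using store_global[OF assms, of _ c] assms by auto

lemma local_active_subset: "i < m \<Longrightarrow> local_active c i \<subseteq> {..<n}"
  unfolding local_active_def by (rule edge_store.active_nodes_subset[OF edges])

lemma nonzero_nodes_eq:
  "{v. v < len \<and> vsymbol (n - 1) (store c) v \<noteq> 0\<^sub>v (n - 1)} =
    (\<lambda>(i, v). i * n + v) ` (SIGMA i:{..<m}. local_active c i) \<union> (\<lambda>g. m * n + g) ` global_active c"
proof (intro equalityI subsetI)
  fix v assume "v \<in> {v. v < len \<and> vsymbol (n - 1) (store c) v \<noteq> 0\<^sub>v (n - 1)}"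
  then have v: "v < len" "vsymbol (n - 1) (store c) v \<noteq> 0\<^sub>v (n - 1)" by simp_all
  from v(1) show "v \<in> (\<lambda>(i, v). i * n + v) ` (SIGMA i:{..<m}. local_active c i) \<union> (\<lambda>g. m * n + g) ` global_active c"
  proof (cases rule: node_cases)
    case (local i u)
    then have "u \<in> local_active c i" using v(2) node_nonzero_local by blast
    then show ?thesis using local by force
  next
    case (global g)
    then show ?thesis using v(2) node_nonzero_global by blast
  qed
next
  fix v assume "v \<in> (\<lambda>(i, v). i * n + v) ` (SIGMA i:{..<m}. local_active c i) \<union> (\<lambda>g. m * n + g) ` global_active c"
  then consider (local) i u where "i < m" "u \<in> local_active c i" "v = i * n + u"
    | (global) g where "g \<in> global_active c" "v = m * n + g" by auto
  then show "v \<in> {v. v < len \<and> vsymbol (n - 1) (store c) v \<noteq> 0\<^sub>v (n - 1)}"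
  proof cases
    case local
    then have "u < n" using local_active_subset by blast
    then show ?thesis using local node_nonzero_local local_node_less by simp
  next
    case global
    then have "g < \<Delta>" by (simp add: global_active_def)
    then show ?thesis using global node_nonzero_global by simp
  qed
qed

lemma finite_local_active: "i < m \<Longrightarrow> finite (local_active c i)"
  by (rule finite_subset[OF local_active_subset]) auto

lemma finite_global_active: "finite (global_active c)"
  by (simp add: global_active_def)

lemma hamming_weight_store:
  "hamming_weight len (n - 1) (store c) = (\<Sum>i<m. card (local_active c i)) + card (global_active c)"
proof -
  let ?S = "SIGMA i:{..<m}. local_active c i"
  have inj: "inj_on (\<lambda>(i, v). i * n + v) ?S"
  proof (rule inj_onI, clarsimp)
    fix i v i' v' assume a: "i < m" "v \<in> local_active c i" "i' < m" "v' \<in> local_active c i'"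
      and eq: "i * n + v = i' * n + v'"
    have v: "v < n" "v' < n"
      using local_active_subset[OF a(1)] local_active_subset[OF a(3)] a(2,4) by auto
    have "(i * n + v) div n = (i' * n + v') div n" "(i * n + v) mod n = (i' * n + v') mod n"
      by (simp_all only: eq)
    then show "i = i' \<and> v = v'" unfolding block_index_div_mod[OF v(1)] block_index_div_mod[OF v(2)] by blast
  qed
  have "hamming_weight len (n - 1) (store c) =
      card ((\<lambda>(i, v). i * n + v) ` ?S) + card ((\<lambda>g. m * n + g) ` global_active c)"
    unfolding hamming_weight_def nonzero_nodes_eq
  proof (rule card_Un_disjoint)
    show "finite ((\<lambda>(i, v). i * n + v) ` ?S)" using finite_local_active by (intro finite_imageI finite_SigmaI) auto
    show "(\<lambda>(i, v). i * n + v) ` ?S \<inter> (\<lambda>g. m * n + g) ` global_active c = {}"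
    proof -
      have "i * n + v < m * n" if "i < m" "v \<in> local_active c i" for i v
        using local_active_subset[OF that(1)] that by (intro block_index_less) auto
      then show ?thesis by fastforce
    qed
  qed (simp add: finite_global_active)
  also have "card ((\<lambda>(i, v). i * n + v) ` ?S) = (\<Sum>i<m. card (local_active c i))"
    unfolding card_image[OF inj] using finite_local_active by (intro card_SigmaI) auto
  also have "card ((\<lambda>g. m * n + g) ` global_active c) = card (global_active c)"
    by (intro card_image) simp
  finally show ?thesis .
qed

text \<open>Symbols are counted in \<open>A\<close>, so an edge counts once although two nodes store
  it. A nonzero local symbol needs an edge between active nodes, a nonzero global parity one of the
  \<open>n - 1\<close> places of an active global node.\<close>

lemma support_le:
  "card {y. y < N \<and> c $ y \<noteq> 0} \<le>
    (\<Sum>i<m. card (local_active c i) choose 2) + card (global_active c) * (n - 1)"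
proof -
  let ?E = "\<lambda>i. {s. s < L \<and> c $ (i * L + s) \<noteq> 0}"
  let ?X = "(\<lambda>(i, s). i * L + s) ` (SIGMA i:{..<m}. ?E i)"
  let ?Y = "(\<lambda>x. m * L + grp x) ` (global_active c \<times> {..<n - 1})"
  have fin: "finite ?X" "finite ?Y" by (auto simp: finite_global_active)
  have "{y. y < N \<and> c $ y \<noteq> 0} \<subseteq> ?X \<union> ?Y"
  proof
    fix y assume "y \<in> {y. y < N \<and> c $ y \<noteq> 0}"
    then have y: "y < N" "c $ y \<noteq> 0" by simp_all
    show "y \<in> ?X \<union> ?Y"
    proof (cases "y < m * L")
      case True
      note s = block_index_split[OF True]
      have "(y div L, y mod L) \<in> (SIGMA i:{..<m}. ?E i)" using s y(2) by simp
      then have "(\<lambda>(i, s). i * L + s) (y div L, y mod L) \<in> ?X" by (rule imageI)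
      then show ?thesis using s(3) by simp
    next
      case False
      then have "y - m * L \<in> grp ` ({..<\<Delta>} \<times> {..<n - 1})"
        unfolding bij_betw_imp_surj_on[OF grp] using y(1) by auto
      then obtain g j where gj: "g < \<Delta>" "j < n - 1" "y - m * L = grp (g, j)" by auto
      then have y': "y = m * L + grp (g, j)" using False by simp
      then have "g \<in> global_active c" unfolding global_active_def using gj y(2) by blast
      then show ?thesis using gj(2) y' by blast
    qed
  qed
  then have "card {y. y < N \<and> c $ y \<noteq> 0} \<le> card (?X \<union> ?Y)" using fin by (intro card_mono) auto
  also have "\<dots> \<le> card ?X + card ?Y" by (rule card_Un_le)
  also have "card ?X \<le> (\<Sum>i<m. card (?E i))"
    by (rule order_trans[OF card_image_le]) (simp_all add: card_SigmaI)
  also have "(\<Sum>i<m. card (?E i)) \<le> (\<Sum>i<m. card (local_active c i) choose 2)"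
    unfolding local_active_def L_eq using edge_store.card_support_le[OF edges] by (intro sum_mono) auto
  also have "card ?Y \<le> card (global_active c) * (n - 1)"
    by (rule order_trans[OF card_image_le]) (simp_all add: finite_global_active card_cartesian_product)
  finally show ?thesis by simp
qed

text \<open>Suppose at most \<open>\<Delta> + q\<close> nodes are nonzero. Each of the
  \<open>x\<close> zero global nodes leaves room for one more local node beyond \<open>q\<close>, at
  a price of at most \<open>n - 1\<close> symbols either way. The support then stays within
  \<open>(q choose 2) + \<Delta> * (n - 1) = e + t\<close>, one below the minimum weight.\<close>

lemma weight_lower:
  assumes c: "c \<in> A" "c \<noteq> 0\<^sub>v N"
  shows "\<Delta> + q + 1 \<le> (\<Sum>i<m. card (local_active c i)) + card (global_active c)"
proof (rule ccontr)
  assume "\<not> ?thesis"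
  then have less: "(\<Sum>i<m. card (local_active c i)) + card (global_active c) \<le> \<Delta> + q" by simp
  have g: "card (global_active c) \<le> \<Delta>"
    using card_mono[of "{..<\<Delta>}" "global_active c"] by (auto simp: global_active_def)
  define x where "x = \<Delta> - card (global_active c)"
  have l: "card (local_active c i) \<le> n" if "i < m" for i
    using card_mono[OF _ local_active_subset[OF that, of c]] by simp
  have "(\<Sum>i<m. card (local_active c i)) \<le> q + x" using less g by (simp add: x_def)
  then have "(\<Sum>i<m. card (local_active c i) choose 2) \<le> (q choose 2) + x * (n - 1)"
    using sum_choose_two_le_excess[of m "\<lambda>i. card (local_active c i)" n q x] l by blast
  moreover have "e + 1 + t \<le> (\<Sum>i<m. card (local_active c i) choose 2) + card (global_active c) * (n - 1)"
    using weight[OF c] support_le[of c] by linarith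
  moreover have "x * (n - 1) + card (global_active c) * (n - 1) = t"
    using g by (simp add: x_def t_eq add_mult_distrib[symmetric])
  ultimately show False using e_eq by linarith
qed

text \<open>A light word of the first local code is extended by zero to the other blocks. Its global
  parities are beyond control, but they add at most \<open>\<Delta>\<close> nonzero nodes, which the
  lower bound already allows for.\<close>

lemma exists_light_word:
  obtains c where "c \<in> A" "c \<noteq> 0\<^sub>v N"
    "(\<Sum>i<m. card (local_active c i)) + card (global_active c) \<le> \<Delta> + q + 1"
proof -
  have m0: "0 < m" using m by simp
  interpret t: transfer_code n "place 0" "slot 0" r q K "local_code 0" by (rule transfer[OF m0])
  obtain b where b: "b \<in> local_code 0" "b \<noteq> 0\<^sub>v (n choose 2)" "card (t.active_nodes (\<lambda>s. b $ s)) \<le> q + 1"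
    by (rule t.exists_light_word)
  obtain c where c: "c \<in> A" "\<And>a. a < L \<Longrightarrow> c $ (0 * L + a) = b $ a"
    "\<And>j a. j < m \<Longrightarrow> j \<noteq> 0 \<Longrightarrow> a < L \<Longrightarrow> c $ (j * L + a) = 0"
    using local_code_extend[OF b(1) m0] by blast
  show thesis
  proof (rule that[OF c(1)])
    show "c \<noteq> 0\<^sub>v N"
    proof
      assume z: "c = 0\<^sub>v N"
      have "b = 0\<^sub>v (n choose 2)"
      proof (rule eq_vecI)
        fix a assume "a < dim_vec (0\<^sub>v (n choose 2) :: 'q vec)"
        then have a: "a < L" using L_eq by simp
        then show "b $ a = 0\<^sub>v (n choose 2) $ a"
          using c(2)[OF a] z block_less[OF m0 a] L_eq by simp
      qed (use t.carrier_M[OF b(1)] in simp)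
      then show False using b(2) by simp
    qed
    have "local_active c 0 = t.active_nodes (\<lambda>s. b $ s)"
      unfolding local_active_def t.active_nodes_def using c(2) L_eq by auto
    then have l0: "card (local_active c 0) \<le> q + 1" using b(3) by simp
    have "local_active c i = {}" if "i < m" "i \<noteq> 0" for i
      unfolding local_active_def edge_store.active_nodes_def[OF edges[OF that(1)]]
      using c(3)[OF that] L_eq by auto
    then have "(\<Sum>i\<in>{..<m} - {0}. card (local_active c i)) = 0" by (intro sum.neutral) auto
    then have "(\<Sum>i<m. card (local_active c i)) \<le> q + 1"
      using l0 m0 by (simp add: sum.remove[of "{..<m}" 0])
    moreover have "card (global_active c) \<le> \<Delta>"
      using card_mono[of "{..<\<Delta>}" "global_active c"] by (auto simp: global_active_def)
    ultimately show "(\<Sum>i<m. card (local_active c i)) + card (global_active c) \<le> \<Delta> + q + 1" by linarith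
  qed
qed

lemma store_zero: "store (0\<^sub>v N) = 0\<^sub>v (len * (n - 1))"
  unfolding store_eq_reindex using source_less by (intro eq_vecI) auto

lemma min_dist_C: "min_dist len (n - 1) C = \<Delta> + (q + 1)"
proof -
  obtain b where b: "b \<in> A" "b \<noteq> 0\<^sub>v N"
    "(\<Sum>i<m. card (local_active b i)) + card (global_active b) \<le> \<Delta> + q + 1"
    by (rule exists_light_word)
  show ?thesis
  proof (rule min_dist_eqI)
    fix c assume c: "c \<in> C" "c \<noteq> 0\<^sub>v (len * (n - 1))"
    then obtain a where a: "a \<in> A" "c = store a" by blast
    then have "a \<noteq> 0\<^sub>v N" using c(2) store_zero by auto
    then show "\<Delta> + (q + 1) \<le> hamming_weight len (n - 1) c"
      unfolding a(2) hamming_weight_store using weight_lower[OF a(1)] by simp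
  next
    show "store b \<in> C" using b(1) by blast
    show "hamming_weight len (n - 1) (store b) \<le> \<Delta> + (q + 1)" unfolding hamming_weight_store using b(3) by simp
    show "store b \<noteq> 0\<^sub>v (len * (n - 1))"
    proof
      assume z: "store b = 0\<^sub>v (len * (n - 1))"
      have "b = 0\<^sub>v N"
      proof (rule zero_if_local_nodes_zero[OF b(1)])
        fix i v j assume ivj: "i < m" "v < n" "j < n - 1"
        show "b $ (i * L + slot i v j) = 0"
          unfolding store_local[OF ivj, symmetric] z
          using block_index_less[OF local_node_less[OF ivj(1,2)] ivj(3)] by simp
      qed
      then show False using b(2) by simp
    qed
  qed
qed

lemma exact_information_locality_C:
  "exact_information_locality len (n - 1) r (q + 1) {..<m} (\<lambda>i. {i * n..<i * n + n}) C"
  unfolding exact_information_locality_def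
proof (intro conjI vector_code_C ballI allI impI rank_local_nodes)
  fix i assume "i \<in> {..<m}"
  then have i: "i < m" by simp
  have "Suc i * n \<le> m * n" using i by (intro mult_le_mono1) simp
  then show "{i * n..<i * n + n} \<subseteq> {..<len}" by auto
  show "card {i * n..<i * n + n} = r + (q + 1) - 1" using n by simp
  show "min_dist (r + (q + 1) - 1) (n - 1) (code_restrict (n - 1) C {i * n..<i * n + n}) = q + 1"
  proof -
    have "r + (q + 1) - 1 = n" using n by simp
    then show ?thesis
      unfolding code_restrict_local[OF i] by (simp only: transfer_code.min_dist_stored[OF transfer[OF i]])
  qed
qed

end

section \<open>The parameters of the construction and the distance formula\<close>

theorem mainTheorem12:
  fixes r \<delta> m \<Delta> n\<^sub>L \<alpha> d \<beta> K\<^sub>L N\<^sub>L \<Delta>\<^sub>L :: nat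
    and A C :: "'q::{field,finite} vec set"
    and place :: "nat \<Rightarrow> nat \<Rightarrow> nat set"
    and slot :: "nat \<Rightarrow> nat \<Rightarrow> nat \<Rightarrow> nat"
    and grp :: "nat \<times> nat \<Rightarrow> nat"
    and S :: "nat \<Rightarrow> nat set"
  assumes "r \<ge> 1" and "\<delta> \<ge> 2" and "m \<ge> 1"
    and "n\<^sub>L = r + \<delta> - 1"
    and "d = n\<^sub>L - 1" and "\<alpha> = d" and "\<beta> = 1"
    and "K\<^sub>L = r * \<alpha> - (r choose 2)"
    and "N\<^sub>L = n\<^sub>L choose 2"
    and "\<Delta>\<^sub>L = N\<^sub>L - K\<^sub>L + 1"
    and "pyramid_code m K\<^sub>L \<Delta>\<^sub>L (\<Delta> * \<alpha>) A"
    and "\<And>i. i < m \<Longrightarrow> edge_placement n\<^sub>L (place i) (slot i)"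
    and "bij_betw grp ({..<\<Delta>} \<times> {..<\<alpha>}) {..<\<Delta> * \<alpha>}"
    and "C = pyramid_store n\<^sub>L m \<Delta> slot grp ` A"
    and "\<And>i. S i = {i * n\<^sub>L..<i * n\<^sub>L + n\<^sub>L}"
  shows "let n = m * n\<^sub>L + \<Delta>; K = code_dim (n * \<alpha>) C in
     vector_code n \<alpha> C \<and>
     mbr_local_code n \<alpha> \<beta> r \<delta> d m S C \<and>
     disjoint_family_on S {..<m} \<and>
     (\<forall>i<m. mbr_code n\<^sub>L r d \<alpha> \<beta> K\<^sub>L (code_restrict \<alpha> C (S i)) \<and>
            repair_by_transfer n\<^sub>L r d \<alpha> \<beta> K\<^sub>L (code_restrict \<alpha> C (S i))) \<and>
     card ({..<n} - (\<Union>i<m. S i)) = \<Delta> \<and>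
     K = m * K\<^sub>L \<and>
     real (min_dist n \<alpha> C) =
       real n - real K / real K\<^sub>L * real r + 1 - (real K / real K\<^sub>L - 1) * (real \<delta> - 1) \<and>
     min_dist n \<alpha> C = \<Delta> + \<delta>"
proof -
  \<comment> \<open>\<open>q\<close> gives \<open>n\<^sub>L = r + q\<close> without truncated
    subtraction; \<open>e\<close> is the number of local parities, since
    \<open>\<Delta>\<^sub>L = e + 1\<close>.\<close>
  define q e where "q = \<delta> - 1" and "e = N\<^sub>L - K\<^sub>L"
  have q: "1 \<le> q" "\<delta> = q + 1" using assms(2) by (simp_all add: q_def)
  have n: "n\<^sub>L = r + q" using assms(4) q by simp
  have \<alpha>: "\<alpha> = n\<^sub>L - 1" "d = n\<^sub>L - 1" using assms(5,6) by simp_all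
  have K: "K\<^sub>L = r * (n\<^sub>L - 1) - (r choose 2)" using assms(8) \<alpha> by simp
  note arith = mbr_dimension_arith[OF assms(1) q(1) K[unfolded n]]
  have K0: "0 < K\<^sub>L" using arith(2) assms(1) q(1) by linarith
  have L: "K\<^sub>L + e = n\<^sub>L choose 2" using arith(1) n assms(9) by (simp add: e_def)
  interpret P: stored_pyramid m K\<^sub>L e "\<Delta> * \<alpha>" A n\<^sub>L r q \<Delta> place slot grp
  proof unfold_locales
    show "pyramid_code m K\<^sub>L (e + 1) (\<Delta> * \<alpha>) A" using assms(10,11) by (simp add: e_def)
    show "\<Delta> * \<alpha> = \<Delta> * (n\<^sub>L - 1)" using \<alpha> by simp
    show "bij_betw grp ({..<\<Delta>} \<times> {..<n\<^sub>L - 1}) {..<\<Delta> * \<alpha>}" using assms(13) \<alpha> by simp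
  qed (fact K0 assms(3) assms(1) q(1) n K L assms(12))+
  have S: "S = (\<lambda>i. {i * n\<^sub>L..<i * n\<^sub>L + n\<^sub>L})" using assms(15) by blast
  have r\<delta>: "r + (q + 1) - 1 = n\<^sub>L" using n by simp
  have local: "mbr_code n\<^sub>L r d \<alpha> \<beta> K\<^sub>L (code_restrict \<alpha> C (S i)) \<and>
      repair_by_transfer n\<^sub>L r d \<alpha> \<beta> K\<^sub>L (code_restrict \<alpha> C (S i))" if i: "i < m" for i
    unfolding \<alpha> assms(7) assms(14) S P.code_restrict_local[OF i]
    using transfer_code.mbr_code_stored[OF P.transfer[OF i]]
      transfer_code.repair_by_transfer_stored[OF P.transfer[OF i]] by blast
  have locality: "exact_information_locality (m * n\<^sub>L + \<Delta>) \<alpha> r \<delta> {..<m} S C"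
    unfolding \<alpha> assms(14) q(2) S by (rule P.exact_information_locality_C)
  have mbr_local: "mbr_local_code (m * n\<^sub>L + \<Delta>) \<alpha> \<beta> r \<delta> d m S C"
    unfolding mbr_local_code_def using locality local unfolding q(2) r\<delta> by blast
  have disj: "disjoint_family_on S {..<m}"
    unfolding disjoint_family_on_def
  proof (intro ballI impI equals0I)
    fix i j x assume "i \<noteq> j" and x: "x \<in> S i \<inter> S j"
    \<comment> \<open>Offsets within the two blocks: a common node would have both \<open>i\<close>
      and \<open>j\<close> as its quotient by \<open>n\<^sub>L\<close>.\<close>
    define a b where "a = x - i * n\<^sub>L" and "b = x - j * n\<^sub>L"
    have "a < n\<^sub>L" "b < n\<^sub>L" "i * n\<^sub>L + a = j * n\<^sub>L + b" using x unfolding a_def b_def S by auto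
    then show False using \<open>i \<noteq> j\<close> block_index_div_mod(1)[of a n\<^sub>L i] block_index_div_mod(1)[of b n\<^sub>L j] by metis
  qed
  have S_un: "(\<Union>i<m. S i) = {..<m * n\<^sub>L}"
  proof (intro equalityI subsetI)
    fix x assume "x \<in> (\<Union>i<m. S i)"
    then obtain i where i: "i < m" "i * n\<^sub>L \<le> x" "x < i * n\<^sub>L + n\<^sub>L" unfolding S by auto
    have "Suc i * n\<^sub>L \<le> m * n\<^sub>L" using i(1) by (intro mult_le_mono1) simp
    then show "x \<in> {..<m * n\<^sub>L}" using i(3) by simp
  next
    fix x assume "x \<in> {..<m * n\<^sub>L}"
    then have x: "x < m * n\<^sub>L" by simp
    note s = block_index_split[OF x]
    have "x div n\<^sub>L * n\<^sub>L \<le> x" "x < x div n\<^sub>L * n\<^sub>L + n\<^sub>L" using s(2,3) by linarith+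
    then have "x \<in> S (x div n\<^sub>L)" unfolding S by simp
    then show "x \<in> (\<Union>i<m. S i)" using s(1) by blast
  qed
  have globals: "card ({..<m * n\<^sub>L + \<Delta>} - (\<Union>i<m. S i)) = \<Delta>"
    unfolding S_un by (subst card_Diff_subset) auto
  have dim: "code_dim ((m * n\<^sub>L + \<Delta>) * \<alpha>) C = m * K\<^sub>L"
    unfolding \<alpha> assms(14) by (rule P.code_dim_C)
  have dist: "min_dist (m * n\<^sub>L + \<Delta>) \<alpha> C = \<Delta> + \<delta>"
    unfolding \<alpha> assms(14) q(2) by (rule P.min_dist_C)
  have vc: "vector_code (m * n\<^sub>L + \<Delta>) \<alpha> C"
    unfolding \<alpha> assms(14) by (rule P.vector_code_C)
  \<comment> \<open>Since \<open>K\<^sub>L\<close> is positive, the quotient is \<open>m\<close>;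
    with \<open>n\<^sub>L = r + q\<close> the right side becomes
    \<open>m * q + \<Delta> + 1 - (m - 1) * q\<close>.\<close>
  have "real (\<Delta> + \<delta>) = real (m * n\<^sub>L + \<Delta>) - real (m * K\<^sub>L) / real K\<^sub>L * real r + 1
      - (real (m * K\<^sub>L) / real K\<^sub>L - 1) * (real \<delta> - 1)"
    using K0 by (simp add: n q(2) algebra_simps)
  then show ?thesis
    unfolding Let_def dim dist using vc mbr_local disj local globals by blast
qed

end
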